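(* Let $\mathcal C$ be a small additive idempotent complete strict ribbon category enriched over $\mathcal{V}ect_k$, with $k$ a field, whose tensor unit $\mathbf 1$ is simple and absolutely simple, and let $A$ be a symmetric special Frobenius algebra in $\mathcal C$. Then there is an exact sequence of groups $$1 \to \mathrm{Inn}(A) \to \mathrm{Aut}(A) \to \mathrm{Pic}(\mathcal C_{A|A}),$$ in which $\mathrm{Inn}(A)\to\mathrm{Aut}(A)$ is the inclusion.
   Context: Absolutely simple means $\mathrm{End}(\mathbf 1)=k\,\mathrm{id}_{\mathbf 1}$; $\mathcal{V}ect_k$ is the category of finite-dimensional $k$-vector spaces. In a ribbon category, $d_U:U^\vee\otimes U\to\mathbf 1$, $b_U:\mathbf 1\to U\otimes U^\vee$ denote the left duality and $\tilde d_U:U\otimes U^\vee\to\mathbf 1$, $\tilde b_U:\mathbf 1\to U^\vee\otimes U$ the right duality (which agrees with the left one as a functor). A Frobenius algebra $A=(A,m,\eta,\Delta,\varepsilon)$ in $\mathcal C$ consists of a unital associative algebra $(A,m,\eta)$ and a counital coassociative coalgebra $(A,\Delta,\varepsilon)$ such that $(\mathrm{id}_A\otimes m)\circ(\Delta\otimes\mathrm{id}_A)=\Delta\circ m=(m\otimes\mathrm{id}_A)\circ(\mathrm{id}_A\otimes\Delta)$. It is special iff $\varepsilon\circ\eta$ and $m\circ\Delta$ are nonzero multiples of $\mathrm{id}_{\mathbf 1}$ and $\mathrm{id}_A$, respectively; by convention these are normalized so that $\varepsilon\circ\eta=\dim(A)\,\mathrm{id}_{\mathbf 1}$ and $m\circ\Delta=\mathrm{id}_A$.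 It is symmetric iff $((\varepsilon\circ m)\otimes\mathrm{id}_{A^\vee})\circ(\mathrm{id}_A\otimes b_A)=(\mathrm{id}_{A^\vee}\otimes(\varepsilon\circ m))\circ(\tilde b_A\otimes\mathrm{id}_A)$ in $\mathrm{Hom}(A,A^\vee)$. $\mathrm{Aut}(A)$ is the group (under composition) of isomorphisms $\varphi\in\mathrm{End}(A)$ with $m\circ(\varphi\otimes\varphi)=\varphi\circ m$ and $\varphi\circ\eta=\eta$. $A_\circ:=\mathrm{Hom}(\mathbf 1,A)$ is a $k$-algebra with unit $\eta$ and product $\alpha*\beta:=m\circ(\alpha\otimes\beta)$; $A_\circ^\times$ is its group of invertible elements. For $\alpha\in A_\circ^\times$ set $\varpi_\alpha:=m\circ(m\otimes\alpha^{-1})\circ(\alpha\otimes\mathrm{id}_A)\in\mathrm{End}(A)$. The group of inner automorphisms is $\mathrm{Inn}(A):=\{\varpi_\alpha\mid\alpha\in A_\circ^\times\}$. $\mathcal C_{A|A}$ is the monoidal category of $A$-bimodules in $\mathcal C$ with tensor product $\otimes_A$ and tensor unit $A$; $\mathrm{Pic}(\mathcal C_{A|A})$ is the group of isomorphism classes of its invertible objects, with product induced by $\otimes_A$. *)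

theory Defs
  imports "HOL-Algebra.Module" "HOL-Algebra.Coset"
begin

section \<open>Categories\<close>

text \<open>
  A small category is given by a set of objects and a set of arrows. The field
  \<open>g \<cdot> f\<close> is the composite "\<open>g\<close> after \<open>f\<close>"; all operations are total HOL functions
  whose values matter only on the carriers (and, for composition, on composable arrows).
\<close>

record ('o, 'm) category_data =
  Obj :: "'o set"
  Arr :: "'m set"
  Dom :: "'m \<Rightarrow> 'o"
  Cod :: "'m \<Rightarrow> 'o"
  ident :: "'o \<Rightarrow> 'm"
  comp :: "'m \<Rightarrow> 'm \<Rightarrow> 'm"  (infixl "\<cdot>\<index>" 65)

definition Hom :: "('o, 'm, 'z) category_data_scheme \<Rightarrow> 'o \<Rightarrow> 'o \<Rightarrow> 'm set" where
  "Hom C U V = {f \<in> Arr C. Dom C f = U \<and> Cod C f = V}"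

locale category =
  fixes C :: "('o, 'm, 'z) category_data_scheme" (structure)
  assumes Dom_closed: "f \<in> Arr C \<Longrightarrow> Dom C f \<in> Obj C"
    and Cod_closed: "f \<in> Arr C \<Longrightarrow> Cod C f \<in> Obj C"
    and ident_in: "U \<in> Obj C \<Longrightarrow> ident C U \<in> Hom C U U"
    and comp_in: "\<lbrakk>f \<in> Hom C U V; g \<in> Hom C V W\<rbrakk> \<Longrightarrow> g \<cdot> f \<in> Hom C U W"
    and comp_assoc: "\<lbrakk>f \<in> Hom C U V; g \<in> Hom C V W; h \<in> Hom C W X\<rbrakk>
          \<Longrightarrow> (h \<cdot> g) \<cdot> f = h \<cdot> (g \<cdot> f)"
    and ident_left: "f \<in> Hom C U V \<Longrightarrow> ident C V \<cdot> f = f"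
    and ident_right: "f \<in> Hom C U V \<Longrightarrow> f \<cdot> ident C U = f"

definition is_iso :: "('o, 'm, 'z) category_data_scheme \<Rightarrow> 'm \<Rightarrow> bool" where
  "is_iso C f \<longleftrightarrow> f \<in> Arr C \<and>
     (\<exists>g \<in> Hom C (Cod C f) (Dom C f). g \<cdot> f = ident C (Dom C f) \<and> f \<cdot> g = ident C (Cod C f))"
  for C (structure)

definition is_mono :: "('o, 'm, 'z) category_data_scheme \<Rightarrow> 'm \<Rightarrow> bool" where
  "is_mono C f \<longleftrightarrow> f \<in> Arr C \<and>
     (\<forall>T \<in> Obj C. \<forall>g \<in> Hom C T (Dom C f). \<forall>h \<in> Hom C T (Dom C f). f \<cdot> g = f \<cdot> h \<longrightarrow> g = h)"
  for C (structure)

definition is_coequalizer ::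
    "('o, 'm, 'z) category_data_scheme \<Rightarrow> 'm \<Rightarrow> 'm \<Rightarrow> 'm \<Rightarrow> bool" where
  "is_coequalizer C f g p \<longleftrightarrow>
     f \<in> Arr C \<and> g \<in> Hom C (Dom C f) (Cod C f) \<and> p \<in> Arr C \<and> Dom C p = Cod C f \<and>
     p \<cdot> f = p \<cdot> g \<and>
     (\<forall>T \<in> Obj C. \<forall>h \<in> Hom C (Cod C f) T. h \<cdot> f = h \<cdot> g \<longrightarrow>
        (\<exists>!u. u \<in> Hom C (Cod C p) T \<and> u \<cdot> p = h))"
  for C (structure)

definition idempotent_complete :: "('o, 'm, 'z) category_data_scheme \<Rightarrow> bool" where
  "idempotent_complete C \<longleftrightarrow>
     (\<forall>U \<in> Obj C. \<forall>p \<in> Hom C U U. p \<cdot> p = p \<longrightarrow>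
        (\<exists>V \<in> Obj C. \<exists>e \<in> Hom C V U. \<exists>r \<in> Hom C U V. r \<cdot> e = ident C V \<and> e \<cdot> r = p))"
  for C (structure)


section \<open>Linear categories\<close>

record ('o, 'm, 'k) linear_data = "('o, 'm) category_data" +
  hom_add :: "'m \<Rightarrow> 'm \<Rightarrow> 'm"  (infixl "\<boxplus>\<index>" 60)
  hom_zero :: "'o \<Rightarrow> 'o \<Rightarrow> 'm"
  hom_scale :: "'k \<Rightarrow> 'm \<Rightarrow> 'm"

text \<open>
  The vector space of arrows from \<open>U\<close> to \<open>V\<close>. The record type \<open>module\<close> extends \<open>ring\<close>; the
  locale predicate \<open>module\<close> ignores the two multiplicative fields.
\<close>

definition hom_module ::
    "('o, 'm, 'k, 'z) linear_data_scheme \<Rightarrow> 'o \<Rightarrow> 'o \<Rightarrow> ('k, 'm) module" where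
  "hom_module C U V =
     \<lparr>carrier = Hom C U V, monoid.mult = undefined, one = undefined,
      zero = hom_zero C U V, add = hom_add C, smult = hom_scale C\<rparr>"

definition finite_dim :: "('k, 'r) ring_scheme \<Rightarrow> ('k, 'v, 's) module_scheme \<Rightarrow> bool" where
  "finite_dim K M \<longleftrightarrow>
     (\<exists>B. finite B \<and> B \<subseteq> carrier M \<and>
        (\<forall>v \<in> carrier M. \<exists>a \<in> B \<rightarrow> carrier K. v = (\<Oplus>\<^bsub>M\<^esub>b \<in> B. a b \<odot>\<^bsub>M\<^esub> b)))"

locale linear_category = category C
  for K :: "('k, 'r) ring_scheme" and C :: "('o, 'm, 'k, 'z) linear_data_scheme" (structure) +
  assumes field_K: "field K"
    and hom_vector_space: "\<lbrakk>U \<in> Obj C; V \<in> Obj C\<rbrakk> \<Longrightarrow> module K (hom_module C U V)"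
    and hom_finite_dim: "\<lbrakk>U \<in> Obj C; V \<in> Obj C\<rbrakk> \<Longrightarrow> finite_dim K (hom_module C U V)"
    and comp_add_left: "\<lbrakk>f \<in> Hom C U V; g \<in> Hom C V W; g' \<in> Hom C V W\<rbrakk>
          \<Longrightarrow> (g \<boxplus> g') \<cdot> f = g \<cdot> f \<boxplus> g' \<cdot> f"
    and comp_add_right: "\<lbrakk>f \<in> Hom C U V; f' \<in> Hom C U V; g \<in> Hom C V W\<rbrakk>
          \<Longrightarrow> g \<cdot> (f \<boxplus> f') = g \<cdot> f \<boxplus> g \<cdot> f'"
    and comp_scale_left: "\<lbrakk>a \<in> carrier K; f \<in> Hom C U V; g \<in> Hom C V W\<rbrakk>
          \<Longrightarrow> hom_scale C a g \<cdot> f = hom_scale C a (g \<cdot> f)"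
    and comp_scale_right: "\<lbrakk>a \<in> carrier K; f \<in> Hom C U V; g \<in> Hom C V W\<rbrakk>
          \<Longrightarrow> g \<cdot> hom_scale C a f = hom_scale C a (g \<cdot> f)"

definition has_zero_object :: "('o, 'm, 'z) category_data_scheme \<Rightarrow> bool" where
  "has_zero_object C \<longleftrightarrow>
     (\<exists>Z \<in> Obj C. \<forall>U \<in> Obj C. (\<exists>!f. f \<in> Hom C Z U) \<and> (\<exists>!f. f \<in> Hom C U Z))"

definition has_biproducts :: "('o, 'm, 'k, 'z) linear_data_scheme \<Rightarrow> bool" where
  "has_biproducts C \<longleftrightarrow>
     (\<forall>U \<in> Obj C. \<forall>V \<in> Obj C. \<exists>W \<in> Obj C.
        \<exists>i \<in> Hom C U W. \<exists>j \<in> Hom C V W. \<exists>p \<in> Hom C W U. \<exists>q \<in> Hom C W V.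
          p \<cdot> i = ident C U \<and> q \<cdot> j = ident C V \<and>
          p \<cdot> j = hom_zero C V U \<and> q \<cdot> i = hom_zero C U V \<and>
          i \<cdot> p \<boxplus> j \<cdot> q = ident C W)"
  for C (structure)

text \<open>Relative to \<open>linear_category\<close>, which supplies the enrichment.\<close>

definition additive :: "('o, 'm, 'k, 'z) linear_data_scheme \<Rightarrow> bool" where
  "additive C \<longleftrightarrow> has_zero_object C \<and> has_biproducts C"

definition simple_object :: "('o, 'm, 'k, 'z) linear_data_scheme \<Rightarrow> 'o \<Rightarrow> bool" where
  "simple_object C U \<longleftrightarrow> U \<in> Obj C \<and> ident C U \<noteq> hom_zero C U U \<and>
     (\<forall>V \<in> Obj C. \<forall>f \<in> Hom C V U. is_mono C f \<longrightarrow> f = hom_zero C V U \<or> is_iso C f)"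

definition absolutely_simple ::
    "('k, 'r) ring_scheme \<Rightarrow> ('o, 'm, 'k, 'z) linear_data_scheme \<Rightarrow> 'o \<Rightarrow> bool" where
  "absolutely_simple K C U \<longleftrightarrow>
     U \<in> Obj C \<and> Hom C U U = {hom_scale C a (ident C U) | a. a \<in> carrier K}"


section \<open>Strict ribbon categories\<close>

text \<open>
  The arrows \<open>ev U : dual U \<otimes> U \<rightarrow> 1\<close> and \<open>coev U : 1 \<rightarrow> U \<otimes> dual U\<close> are $d_U$ and $b_U$;
  \<open>braid U V : U \<otimes> V \<rightarrow> V \<otimes> U\<close>.
\<close>

record ('o, 'm, 'k) ribbon_data = "('o, 'm, 'k) linear_data" +
  unit :: "'o"
  tensor_obj :: "'o \<Rightarrow> 'o \<Rightarrow> 'o"  (infixl "\<otimes>\<^sub>o\<index>" 70)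
  tensor_arr :: "'m \<Rightarrow> 'm \<Rightarrow> 'm"  (infixl "\<otimes>\<^sub>a\<index>" 70)
  dual :: "'o \<Rightarrow> 'o"
  ev :: "'o \<Rightarrow> 'm"
  coev :: "'o \<Rightarrow> 'm"
  braid :: "'o \<Rightarrow> 'o \<Rightarrow> 'm"
  twist :: "'o \<Rightarrow> 'm"

locale strict_monoidal_linear_category = linear_category K C
  for K :: "('k, 'r) ring_scheme" and C :: "('o, 'm, 'k, 'z) ribbon_data_scheme" (structure) +
  assumes unit_in: "unit C \<in> Obj C"
    and tensor_obj_in: "\<lbrakk>U \<in> Obj C; V \<in> Obj C\<rbrakk> \<Longrightarrow> U \<otimes>\<^sub>o V \<in> Obj C"
    and tensor_arr_in: "\<lbrakk>f \<in> Hom C U V; g \<in> Hom C X Y\<rbrakk>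
          \<Longrightarrow> f \<otimes>\<^sub>a g \<in> Hom C (U \<otimes>\<^sub>o X) (V \<otimes>\<^sub>o Y)"
    and tensor_ident: "\<lbrakk>U \<in> Obj C; V \<in> Obj C\<rbrakk>
          \<Longrightarrow> ident C U \<otimes>\<^sub>a ident C V = ident C (U \<otimes>\<^sub>o V)"
    and interchange: "\<lbrakk>f \<in> Hom C U V; f' \<in> Hom C V W; g \<in> Hom C X Y; g' \<in> Hom C Y Z\<rbrakk>
          \<Longrightarrow> (f' \<cdot> f) \<otimes>\<^sub>a (g' \<cdot> g) = (f' \<otimes>\<^sub>a g') \<cdot> (f \<otimes>\<^sub>a g)"
    and tensor_obj_assoc: "\<lbrakk>U \<in> Obj C; V \<in> Obj C; W \<in> Obj C\<rbrakk>
          \<Longrightarrow> (U \<otimes>\<^sub>o V) \<otimes>\<^sub>o W = U \<otimes>\<^sub>o (V \<otimes>\<^sub>o W)"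
    and tensor_arr_assoc: "\<lbrakk>f \<in> Arr C; g \<in> Arr C; h \<in> Arr C\<rbrakk>
          \<Longrightarrow> (f \<otimes>\<^sub>a g) \<otimes>\<^sub>a h = f \<otimes>\<^sub>a (g \<otimes>\<^sub>a h)"
    and unit_tensor_obj: "U \<in> Obj C \<Longrightarrow> unit C \<otimes>\<^sub>o U = U"
    and tensor_obj_unit: "U \<in> Obj C \<Longrightarrow> U \<otimes>\<^sub>o unit C = U"
    and unit_tensor_arr: "f \<in> Arr C \<Longrightarrow> ident C (unit C) \<otimes>\<^sub>a f = f"
    and tensor_arr_unit: "f \<in> Arr C \<Longrightarrow> f \<otimes>\<^sub>a ident C (unit C) = f"
    and tensor_add_left: "\<lbrakk>f \<in> Hom C U V; f' \<in> Hom C U V; g \<in> Hom C X Y\<rbrakk>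
          \<Longrightarrow> (f \<boxplus> f') \<otimes>\<^sub>a g = (f \<otimes>\<^sub>a g) \<boxplus> (f' \<otimes>\<^sub>a g)"
    and tensor_add_right: "\<lbrakk>f \<in> Hom C U V; g \<in> Hom C X Y; g' \<in> Hom C X Y\<rbrakk>
          \<Longrightarrow> f \<otimes>\<^sub>a (g \<boxplus> g') = (f \<otimes>\<^sub>a g) \<boxplus> (f \<otimes>\<^sub>a g')"
    and tensor_scale_left: "\<lbrakk>a \<in> carrier K; f \<in> Arr C; g \<in> Arr C\<rbrakk>
          \<Longrightarrow> hom_scale C a f \<otimes>\<^sub>a g = hom_scale C a (f \<otimes>\<^sub>a g)"
    and tensor_scale_right: "\<lbrakk>a \<in> carrier K; f \<in> Arr C; g \<in> Arr C\<rbrakk>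
          \<Longrightarrow> f \<otimes>\<^sub>a hom_scale C a g = hom_scale C a (f \<otimes>\<^sub>a g)"

locale strict_ribbon_category = strict_monoidal_linear_category K C
  for K :: "('k, 'r) ring_scheme" and C :: "('o, 'm, 'k, 'z) ribbon_data_scheme" (structure) +
  assumes dual_in: "U \<in> Obj C \<Longrightarrow> dual C U \<in> Obj C"
    and ev_in: "U \<in> Obj C \<Longrightarrow> ev C U \<in> Hom C (dual C U \<otimes>\<^sub>o U) (unit C)"
    and coev_in: "U \<in> Obj C \<Longrightarrow> coev C U \<in> Hom C (unit C) (U \<otimes>\<^sub>o dual C U)"
    and duality_obj: "U \<in> Obj C
          \<Longrightarrow> (ident C U \<otimes>\<^sub>a ev C U) \<cdot> (coev C U \<otimes>\<^sub>a ident C U) = ident C U"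
    and duality_dual: "U \<in> Obj C
          \<Longrightarrow> (ev C U \<otimes>\<^sub>a ident C (dual C U)) \<cdot> (ident C (dual C U) \<otimes>\<^sub>a coev C U)
              = ident C (dual C U)"
    and braid_in: "\<lbrakk>U \<in> Obj C; V \<in> Obj C\<rbrakk> \<Longrightarrow> braid C U V \<in> Hom C (U \<otimes>\<^sub>o V) (V \<otimes>\<^sub>o U)"
    and braid_iso: "\<lbrakk>U \<in> Obj C; V \<in> Obj C\<rbrakk> \<Longrightarrow> is_iso C (braid C U V)"
    and braid_natural: "\<lbrakk>f \<in> Hom C U V; g \<in> Hom C X Y\<rbrakk>
          \<Longrightarrow> (g \<otimes>\<^sub>a f) \<cdot> braid C U X = braid C V Y \<cdot> (f \<otimes>\<^sub>a g)"
    and hexagon_left: "\<lbrakk>U \<in> Obj C; V \<in> Obj C; W \<in> Obj C\<rbrakk>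
          \<Longrightarrow> braid C (U \<otimes>\<^sub>o V) W = (braid C U W \<otimes>\<^sub>a ident C V) \<cdot> (ident C U \<otimes>\<^sub>a braid C V W)"
    and hexagon_right: "\<lbrakk>U \<in> Obj C; V \<in> Obj C; W \<in> Obj C\<rbrakk>
          \<Longrightarrow> braid C U (V \<otimes>\<^sub>o W) = (ident C V \<otimes>\<^sub>a braid C U W) \<cdot> (braid C U V \<otimes>\<^sub>a ident C W)"
    and twist_in: "U \<in> Obj C \<Longrightarrow> twist C U \<in> Hom C U U"
    and twist_iso: "U \<in> Obj C \<Longrightarrow> is_iso C (twist C U)"
    and twist_natural: "f \<in> Hom C U V \<Longrightarrow> f \<cdot> twist C U = twist C V \<cdot> f"
    and twist_tensor: "\<lbrakk>U \<in> Obj C; V \<in> Obj C\<rbrakk>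
          \<Longrightarrow> twist C (U \<otimes>\<^sub>o V) = braid C V U \<cdot> braid C U V \<cdot> (twist C U \<otimes>\<^sub>a twist C V)"
    and twist_dual: "U \<in> Obj C
          \<Longrightarrow> (twist C U \<otimes>\<^sub>a ident C (dual C U)) \<cdot> coev C U
              = (ident C U \<otimes>\<^sub>a twist C (dual C U)) \<cdot> coev C U"

text \<open>The right duality $\tilde d_U$, $\tilde b_U$ determined by the ribbon structure.\<close>

definition ev_right :: "('o, 'm, 'k, 'z) ribbon_data_scheme \<Rightarrow> 'o \<Rightarrow> 'm" where
  "ev_right C U = ev C U \<cdot> braid C U (dual C U) \<cdot> (twist C U \<otimes>\<^sub>a ident C (dual C U))"
  for C (structure)

definition coev_right :: "('o, 'm, 'k, 'z) ribbon_data_scheme \<Rightarrow> 'o \<Rightarrow> 'm" where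
  "coev_right C U = (ident C (dual C U) \<otimes>\<^sub>a twist C U) \<cdot> braid C U (dual C U) \<cdot> coev C U"
  for C (structure)

text \<open>The dimension, as an endomorphism of the tensor unit (i.e. \<open>dim(U) id\<close>).\<close>

definition dim_arr :: "('o, 'm, 'k, 'z) ribbon_data_scheme \<Rightarrow> 'o \<Rightarrow> 'm" where
  "dim_arr C U = ev_right C U \<cdot> coev C U"
  for C (structure)


section \<open>Symmetric special Frobenius algebras\<close>

record ('o, 'm) frobenius_data =
  aobj :: "'o"
  mul :: "'m"
  unt :: "'m"
  cmul :: "'m"
  cunt :: "'m"

definition is_algebra ::
    "('o, 'm, 'k, 'z) ribbon_data_scheme \<Rightarrow> ('o, 'm) frobenius_data \<Rightarrow> bool" where
  "is_algebra C A \<longleftrightarrow>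
     aobj A \<in> Obj C \<and>
     mul A \<in> Hom C (aobj A \<otimes>\<^sub>o aobj A) (aobj A) \<and>
     unt A \<in> Hom C (unit C) (aobj A) \<and>
     mul A \<cdot> (mul A \<otimes>\<^sub>a ident C (aobj A)) = mul A \<cdot> (ident C (aobj A) \<otimes>\<^sub>a mul A) \<and>
     mul A \<cdot> (unt A \<otimes>\<^sub>a ident C (aobj A)) = ident C (aobj A) \<and>
     mul A \<cdot> (ident C (aobj A) \<otimes>\<^sub>a unt A) = ident C (aobj A)"
  for C (structure)

definition is_coalgebra ::
    "('o, 'm, 'k, 'z) ribbon_data_scheme \<Rightarrow> ('o, 'm) frobenius_data \<Rightarrow> bool" where
  "is_coalgebra C A \<longleftrightarrow>
     aobj A \<in> Obj C \<and>
     cmul A \<in> Hom C (aobj A) (aobj A \<otimes>\<^sub>o aobj A) \<and>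
     cunt A \<in> Hom C (aobj A) (unit C) \<and>
     (cmul A \<otimes>\<^sub>a ident C (aobj A)) \<cdot> cmul A = (ident C (aobj A) \<otimes>\<^sub>a cmul A) \<cdot> cmul A \<and>
     (cunt A \<otimes>\<^sub>a ident C (aobj A)) \<cdot> cmul A = ident C (aobj A) \<and>
     (ident C (aobj A) \<otimes>\<^sub>a cunt A) \<cdot> cmul A = ident C (aobj A)"
  for C (structure)

definition is_frobenius_algebra ::
    "('o, 'm, 'k, 'z) ribbon_data_scheme \<Rightarrow> ('o, 'm) frobenius_data \<Rightarrow> bool" where
  "is_frobenius_algebra C A \<longleftrightarrow>
     is_algebra C A \<and> is_coalgebra C A \<and>
     (ident C (aobj A) \<otimes>\<^sub>a mul A) \<cdot> (cmul A \<otimes>\<^sub>a ident C (aobj A)) = cmul A \<cdot> mul A \<and>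
     cmul A \<cdot> mul A = (mul A \<otimes>\<^sub>a ident C (aobj A)) \<cdot> (ident C (aobj A) \<otimes>\<^sub>a cmul A)"
  for C (structure)

text \<open>Special, with the usual normalization built in.\<close>

definition is_special ::
    "('k, 'r) ring_scheme \<Rightarrow> ('o, 'm, 'k, 'z) ribbon_data_scheme
      \<Rightarrow> ('o, 'm) frobenius_data \<Rightarrow> bool" where
  "is_special K C A \<longleftrightarrow>
     (\<exists>a \<in> carrier K. a \<noteq> \<zero>\<^bsub>K\<^esub> \<and> cunt A \<cdot> unt A = hom_scale C a (ident C (unit C))) \<and>
     (\<exists>a \<in> carrier K. a \<noteq> \<zero>\<^bsub>K\<^esub> \<and> mul A \<cdot> cmul A = hom_scale C a (ident C (aobj A))) \<and>
     cunt A \<cdot> unt A = dim_arr C (aobj A) \<and>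
     mul A \<cdot> cmul A = ident C (aobj A)"
  for K and C (structure)

definition is_symmetric ::
    "('o, 'm, 'k, 'z) ribbon_data_scheme \<Rightarrow> ('o, 'm) frobenius_data \<Rightarrow> bool" where
  "is_symmetric C A \<longleftrightarrow>
     ((cunt A \<cdot> mul A) \<otimes>\<^sub>a ident C (dual C (aobj A))) \<cdot> (ident C (aobj A) \<otimes>\<^sub>a coev C (aobj A))
     = (ident C (dual C (aobj A)) \<otimes>\<^sub>a (cunt A \<cdot> mul A))
         \<cdot> (coev_right C (aobj A) \<otimes>\<^sub>a ident C (aobj A))"
  for C (structure)


section \<open>Automorphisms\<close>

definition Aut ::
    "('o, 'm, 'k, 'z) ribbon_data_scheme \<Rightarrow> ('o, 'm) frobenius_data \<Rightarrow> 'm monoid" where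
  "Aut C A =
     \<lparr>carrier = {\<phi> \<in> Hom C (aobj A) (aobj A). is_iso C \<phi> \<and>
                   mul A \<cdot> (\<phi> \<otimes>\<^sub>a \<phi>) = \<phi> \<cdot> mul A \<and> \<phi> \<cdot> unt A = unt A},
      monoid.mult = category_data.comp C,
      one = ident C (aobj A)\<rparr>"
  for C (structure)

text \<open>The multiplicative monoid of the algebra of arrows from the tensor unit to \<open>A\<close>.\<close>

definition points ::
    "('o, 'm, 'k, 'z) ribbon_data_scheme \<Rightarrow> ('o, 'm) frobenius_data \<Rightarrow> 'm monoid" where
  "points C A =
     \<lparr>carrier = Hom C (unit C) (aobj A),
      monoid.mult = (\<lambda>\<alpha> \<beta>. mul A \<cdot> (\<alpha> \<otimes>\<^sub>a \<beta>)),
      one = unt A\<rparr>"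
  for C (structure)

definition inner_aut ::
    "('o, 'm, 'k, 'z) ribbon_data_scheme \<Rightarrow> ('o, 'm) frobenius_data \<Rightarrow> 'm \<Rightarrow> 'm" where
  "inner_aut C A \<alpha> =
     mul A \<cdot> (mul A \<otimes>\<^sub>a (inv\<^bsub>points C A\<^esub> \<alpha>)) \<cdot> (\<alpha> \<otimes>\<^sub>a ident C (aobj A))"
  for C (structure)

definition Inn ::
    "('o, 'm, 'k, 'z) ribbon_data_scheme \<Rightarrow> ('o, 'm) frobenius_data \<Rightarrow> 'm monoid" where
  "Inn C A = (Aut C A)\<lparr>carrier := {inner_aut C A \<alpha> | \<alpha>. \<alpha> \<in> Units (points C A)}\<rparr>"


section \<open>Bimodules and their Picard group\<close>

record ('o, 'm) bimodule_data =
  bobj :: "'o"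
  lact :: "'m"
  ract :: "'m"

definition is_bimodule ::
    "('o, 'm, 'k, 'z) ribbon_data_scheme \<Rightarrow> ('o, 'm) frobenius_data
      \<Rightarrow> ('o, 'm) bimodule_data \<Rightarrow> bool" where
  "is_bimodule C A X \<longleftrightarrow>
     bobj X \<in> Obj C \<and>
     lact X \<in> Hom C (aobj A \<otimes>\<^sub>o bobj X) (bobj X) \<and>
     ract X \<in> Hom C (bobj X \<otimes>\<^sub>o aobj A) (bobj X) \<and>
     lact X \<cdot> (mul A \<otimes>\<^sub>a ident C (bobj X)) = lact X \<cdot> (ident C (aobj A) \<otimes>\<^sub>a lact X) \<and>
     lact X \<cdot> (unt A \<otimes>\<^sub>a ident C (bobj X)) = ident C (bobj X) \<and>
     ract X \<cdot> (ident C (bobj X) \<otimes>\<^sub>a mul A) = ract X \<cdot> (ract X \<otimes>\<^sub>a ident C (aobj A)) \<and>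
     ract X \<cdot> (ident C (bobj X) \<otimes>\<^sub>a unt A) = ident C (bobj X) \<and>
     lact X \<cdot> (ident C (aobj A) \<otimes>\<^sub>a ract X) = ract X \<cdot> (lact X \<otimes>\<^sub>a ident C (aobj A))"
  for C (structure)

definition bimodule_hom ::
    "('o, 'm, 'k, 'z) ribbon_data_scheme \<Rightarrow> ('o, 'm) frobenius_data
      \<Rightarrow> ('o, 'm) bimodule_data \<Rightarrow> ('o, 'm) bimodule_data \<Rightarrow> 'm set" where
  "bimodule_hom C A X Y =
     {f \<in> Hom C (bobj X) (bobj Y).
        f \<cdot> lact X = lact Y \<cdot> (ident C (aobj A) \<otimes>\<^sub>a f) \<and>
        f \<cdot> ract X = ract Y \<cdot> (f \<otimes>\<^sub>a ident C (aobj A))}"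
  for C (structure)

definition bimodule_iso ::
    "('o, 'm, 'k, 'z) ribbon_data_scheme \<Rightarrow> ('o, 'm) frobenius_data
      \<Rightarrow> ('o, 'm) bimodule_data \<Rightarrow> ('o, 'm) bimodule_data \<Rightarrow> bool" where
  "bimodule_iso C A X Y \<longleftrightarrow>
     (\<exists>f \<in> bimodule_hom C A X Y. \<exists>g \<in> bimodule_hom C A Y X.
        g \<cdot> f = ident C (bobj X) \<and> f \<cdot> g = ident C (bobj Y))"
  for C (structure)

definition regular_bimodule :: "('o, 'm) frobenius_data \<Rightarrow> ('o, 'm) bimodule_data" where
  "regular_bimodule A = \<lparr>bobj = aobj A, lact = mul A, ract = mul A\<rparr>"

text \<open>
  \<open>Z\<close> is a tensor product of \<open>X\<close> and \<open>Y\<close> over \<open>A\<close>: the underlying object is a coequalizer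
  \<open>p : X \<otimes> Y \<rightarrow> Z\<close> of the two middle actions \<open>X \<otimes> A \<otimes> Y \<rightarrow> X \<otimes> Y\<close>, and the outer actions of
  \<open>A\<close> on \<open>X \<otimes> Y\<close> descend along \<open>p\<close> to those of \<open>Z\<close>. This determines \<open>Z\<close> up to isomorphism
  of bimodules, so no choice of representative is made.
\<close>

definition is_tensor_over ::
    "('o, 'm, 'k, 'z) ribbon_data_scheme \<Rightarrow> ('o, 'm) frobenius_data
      \<Rightarrow> ('o, 'm) bimodule_data \<Rightarrow> ('o, 'm) bimodule_data \<Rightarrow> ('o, 'm) bimodule_data \<Rightarrow> bool" where
  "is_tensor_over C A X Y Z \<longleftrightarrow> is_bimodule C A Z \<and>
     (\<exists>p \<in> Hom C (bobj X \<otimes>\<^sub>o bobj Y) (bobj Z).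
        is_coequalizer C (ract X \<otimes>\<^sub>a ident C (bobj Y)) (ident C (bobj X) \<otimes>\<^sub>a lact Y) p \<and>
        lact Z \<cdot> (ident C (aobj A) \<otimes>\<^sub>a p) = p \<cdot> (lact X \<otimes>\<^sub>a ident C (bobj Y)) \<and>
        ract Z \<cdot> (p \<otimes>\<^sub>a ident C (aobj A)) = p \<cdot> (ident C (bobj X) \<otimes>\<^sub>a ract Y))"
  for C (structure)

definition is_invertible_bimodule ::
    "('o, 'm, 'k, 'z) ribbon_data_scheme \<Rightarrow> ('o, 'm) frobenius_data
      \<Rightarrow> ('o, 'm) bimodule_data \<Rightarrow> bool" where
  "is_invertible_bimodule C A X \<longleftrightarrow> is_bimodule C A X \<and>
     (\<exists>Y. is_bimodule C A Y \<and>
        (\<exists>Z. is_tensor_over C A X Y Z \<and> bimodule_iso C A Z (regular_bimodule A)) \<and>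
        (\<exists>W. is_tensor_over C A Y X W \<and> bimodule_iso C A W (regular_bimodule A)))"

definition iso_class ::
    "('o, 'm, 'k, 'z) ribbon_data_scheme \<Rightarrow> ('o, 'm) frobenius_data
      \<Rightarrow> ('o, 'm) bimodule_data \<Rightarrow> ('o, 'm) bimodule_data set" where
  "iso_class C A X = {Y. is_bimodule C A Y \<and> bimodule_iso C A X Y}"

text \<open>
  The product of two classes consists of all tensor products of their members, which is the
  isomorphism class of any one of them.
\<close>

definition Pic ::
    "('o, 'm, 'k, 'z) ribbon_data_scheme \<Rightarrow> ('o, 'm) frobenius_data
      \<Rightarrow> ('o, 'm) bimodule_data set monoid" where
  "Pic C A =
     \<lparr>carrier = {iso_class C A X | X. is_invertible_bimodule C A X},
      monoid.mult = (\<lambda>P Q. {Z. \<exists>X \<in> P. \<exists>Y \<in> Q. is_tensor_over C A X Y Z}),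
      one = iso_class C A (regular_bimodule A)\<rparr>"

end

theory Submission
  imports Defs
begin

text \<open>
  The map from \<open>Aut(A)\<close> to the Picard group sends \<open>\<phi>\<close> to the class of the bimodule
  \<open>A\<^sub>\<phi>\<close>: the object \<open>A\<close> with its own multiplication as left action and with right action
  \<open>m \<circ> (id \<otimes> \<phi>)\<close> (\<open>twisted\<close>). The arrow \<open>m \<circ> (id \<otimes> \<phi>)\<close>, in elements \<open>x \<otimes> y \<mapsto> x \<phi>(y)\<close>,
  identifies \<open>A\<^sub>\<phi> \<otimes>\<^sub>A A\<^sub>\<psi>\<close> with \<open>A\<^sub>\<phi>\<^sub>\<psi>\<close>, so the map is multiplicative (\<open>twisted_tensor\<close>).
  A left-linear arrow out of \<open>A\<close> is right multiplication by its value \<open>\<beta>\<close> at the unit, and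
  this right multiplication is a bimodule arrow from \<open>A\<close> to \<open>A\<^sub>\<phi>\<close> exactly when
  \<open>x \<beta> = \<beta> \<phi>(x)\<close>. It is invertible exactly when \<open>\<beta>\<close> has an inverse \<open>\<alpha>\<close>, and then
  \<open>\<phi>(x) = \<alpha> x \<beta>\<close>. Hence \<open>A\<^sub>\<phi> \<cong> A\<close> if and only if \<open>\<phi>\<close> is inner (\<open>twisted_iso_reg_iff\<close>,
  \<open>Inn_eq_kernel\<close>), which is exactness. As a kernel, \<open>Inn(A)\<close> is then a subgroup.

  The substantial part is that the classes of invertible bimodules form a group at all.
  The element \<open>\<Delta> \<circ> \<eta>\<close> of \<open>A \<otimes> A\<close> defines an idempotent \<open>proj X Y\<close> on \<open>X \<otimes> Y\<close>: insert
  \<open>\<Delta> \<circ> \<eta>\<close> in the middle and let its two legs act on \<open>X\<close> and \<open>Y\<close>. By the Frobenius relations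
  this idempotent coequalizes the two middle actions, and by \<open>m \<circ> \<Delta> = id\<close> every arrow
  that coequalizes them absorbs it. Therefore \<open>X \<otimes>\<^sub>A Y\<close> is the same thing as a splitting of
  \<open>proj X Y\<close> in the category of bimodules (\<open>tensor_over_iff_splits\<close>). Splittings are
  described by equations, so they exist by idempotent completeness, are unique up to
  isomorphism, and are preserved by tensoring with a further bimodule. Associativity
  (\<open>tensor_over_assoc\<close>) follows: both bracketings of a triple product split the same
  idempotent of \<open>X \<otimes> Y \<otimes> Z\<close>. So the classes of all bimodules form a monoid, and
  the Picard group is its group of units (\<open>Pic_eq_units\<close>).
\<close>


section \<open>Arrow calculus in a strict monoidal category\<close>

context strict_monoidal_linear_category
begin

text \<open>
  Composability is tracked through \<open>Dom\<close> and \<open>Cod\<close> instead of membership in a hom-set: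
  the simplifier can then compute the types of composites and tensor products, whereas a
  hom-set condition would leave the intermediate object of a composite to be guessed.
\<close>

lemma Hom_iff [simp]: "f \<in> Hom C U V \<longleftrightarrow> f \<in> Arr C \<and> Dom C f = U \<and> Cod C f = V"
  by (simp add: Hom_def)

lemma HomI: "\<lbrakk>f \<in> Arr C; Dom C f = U; Cod C f = V\<rbrakk> \<Longrightarrow> f \<in> Hom C U V"
  by simp

lemma arr_HomI: "f \<in> Arr C \<Longrightarrow> f \<in> Hom C (Dom C f) (Cod C f)"
  by (simp add: Hom_def)

lemma Dom_Obj [simp]: "f \<in> Arr C \<Longrightarrow> Dom C f \<in> Obj C"
  and Cod_Obj [simp]: "f \<in> Arr C \<Longrightarrow> Cod C f \<in> Obj C"
  by (simp_all add: Dom_closed Cod_closed)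

lemma Hom_Obj:
  assumes "f \<in> Hom C U V"
  shows "U \<in> Obj C" "V \<in> Obj C"
  using assms Dom_Obj Cod_Obj by (auto simp: Hom_def)

lemma ident_arr [simp]:
  assumes "U \<in> Obj C"
  shows "ident C U \<in> Arr C" "Dom C (ident C U) = U" "Cod C (ident C U) = U"
  using ident_in[OF assms] by (auto simp: Hom_def)

lemma comp_arr [simp]:
  assumes "f \<in> Arr C" "g \<in> Arr C" "Dom C g = Cod C f"
  shows "g \<cdot> f \<in> Arr C" "Dom C (g \<cdot> f) = Dom C f" "Cod C (g \<cdot> f) = Cod C g"
proof -
  have "g \<cdot> f \<in> Hom C (Dom C f) (Cod C g)"
    by (rule comp_in[of f _ "Cod C f"]) (use assms in simp_all)
  then show "g \<cdot> f \<in> Arr C" "Dom C (g \<cdot> f) = Dom C f" "Cod C (g \<cdot> f) = Cod C g"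
    by simp_all
qed

lemma tensor_arr [simp]:
  assumes "f \<in> Arr C" "g \<in> Arr C"
  shows "f \<otimes>\<^sub>a g \<in> Arr C" "Dom C (f \<otimes>\<^sub>a g) = Dom C f \<otimes>\<^sub>o Dom C g"
    "Cod C (f \<otimes>\<^sub>a g) = Cod C f \<otimes>\<^sub>o Cod C g"
  using tensor_arr_in[OF arr_HomI[OF assms(1)] arr_HomI[OF assms(2)]] by simp_all

lemma comp_assoc_arr:
  assumes "f \<in> Arr C" "g \<in> Arr C" "h \<in> Arr C" "Dom C g = Cod C f" "Dom C h = Cod C g"
  shows "(h \<cdot> g) \<cdot> f = h \<cdot> (g \<cdot> f)"
  by (rule comp_assoc) (use assms in simp_all)

lemma comp_ident_left [simp]: "\<lbrakk>f \<in> Arr C; Cod C f = U\<rbrakk> \<Longrightarrow> ident C U \<cdot> f = f"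
  and comp_ident_right [simp]: "\<lbrakk>f \<in> Arr C; Dom C f = U\<rbrakk> \<Longrightarrow> f \<cdot> ident C U = f"
  by (auto intro: ident_left ident_right simp: Hom_def)

lemma comp_tensor:
  assumes "f \<in> Arr C" "f' \<in> Arr C" "g \<in> Arr C" "g' \<in> Arr C"
    "Dom C f' = Cod C f" "Dom C g' = Cod C g"
  shows "(f' \<otimes>\<^sub>a g') \<cdot> (f \<otimes>\<^sub>a g) = (f' \<cdot> f) \<otimes>\<^sub>a (g' \<cdot> g)"
  by (rule interchange[symmetric]) (use assms in simp_all)

lemmas obj_simps [simp] =
  unit_in tensor_obj_in tensor_obj_assoc unit_tensor_obj tensor_obj_unit

lemmas arr_unit_simps [simp] = unit_tensor_arr tensor_arr_unit

text \<open>
  A section \<open>s\<close> of \<open>p\<close> whose projector \<open>s \<cdot> p\<close> is absorbed by every coequalizing arrow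
  \<open>h\<close> gives the factorization \<open>h = (h \<cdot> s) \<cdot> p\<close>; uniqueness holds because \<open>p\<close> is split.
\<close>

lemma split_coequalizer:
  assumes f: "f \<in> Hom C U V" "g \<in> Hom C U V" and p: "p \<in> Hom C V W" and s: "s \<in> Hom C W V"
    and pf: "p \<cdot> f = p \<cdot> g" and ps: "p \<cdot> s = ident C W"
    and absorb: "\<And>T h. \<lbrakk>h \<in> Hom C V T; h \<cdot> f = h \<cdot> g\<rbrakk> \<Longrightarrow> h \<cdot> (s \<cdot> p) = h"
  shows "is_coequalizer C f g p"
  unfolding is_coequalizer_def
proof (intro conjI ballI impI)
  show "f \<in> Arr C" "g \<in> Hom C (Dom C f) (Cod C f)" "p \<in> Arr C" "Dom C p = Cod C f"
    using f p by simp_all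
  show "p \<cdot> f = p \<cdot> g" by fact
  fix T h assume h: "h \<in> Hom C (Cod C f) T" "h \<cdot> f = h \<cdot> g"
  have hV: "h \<in> Hom C V T" using h f by simp
  show "\<exists>!u. u \<in> Hom C (Cod C p) T \<and> u \<cdot> p = h"
  proof (rule ex1I[of _ "h \<cdot> s"])
    show "h \<cdot> s \<in> Hom C (Cod C p) T \<and> h \<cdot> s \<cdot> p = h"
      using absorb[OF hV h(2)] hV s p by (auto intro!: HomI simp: comp_assoc_arr)
    fix u assume u: "u \<in> Hom C (Cod C p) T \<and> u \<cdot> p = h"
    then have "h \<cdot> s = u \<cdot> (p \<cdot> s)" using p s by (auto simp flip: comp_assoc_arr)
    then show "u = h \<cdot> s" using u p ps by simp
  qed
qed

end


section \<open>Algebras and the convolution product of arrows\<close>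

locale algebra_object = strict_monoidal_linear_category K C
  for K :: "('k, 'r) ring_scheme" and C :: "('o, 'm, 'k, 'z) ribbon_data_scheme" (structure) +
  fixes A :: "('o, 'm) frobenius_data"
  assumes alg: "is_algebra C A"
begin

abbreviation a :: 'o where "a \<equiv> aobj A"
abbreviation mu :: 'm where "mu \<equiv> mul A"
abbreviation eta :: 'm where "eta \<equiv> unt A"
abbreviation idn :: "'o \<Rightarrow> 'm" where "idn \<equiv> ident C"

lemma algebra_arr [simp]:
  "a \<in> Obj C" "mu \<in> Arr C" "Dom C mu = a \<otimes>\<^sub>o a" "Cod C mu = a"
  "eta \<in> Arr C" "Dom C eta = unit C" "Cod C eta = a"
  using alg by (auto simp: is_algebra_def Hom_def)

lemma algebra_laws:
  "mu \<cdot> (mu \<otimes>\<^sub>a idn a) = mu \<cdot> (idn a \<otimes>\<^sub>a mu)"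
  "mu \<cdot> (eta \<otimes>\<^sub>a idn a) = idn a"
  "mu \<cdot> (idn a \<otimes>\<^sub>a eta) = idn a"
  using alg by (auto simp: is_algebra_def)

text \<open>
  The product of generalized elements \<open>U \<rightarrow> A\<close> and \<open>V \<rightarrow> A\<close>, defined on \<open>U \<otimes> V\<close>. Strictness
  makes it associative and unital on the nose, so that identities between arrows into \<open>A\<close>
  can be checked as in a monoid.
\<close>

definition conv :: "'m \<Rightarrow> 'm \<Rightarrow> 'm"  (infixl "\<star>" 68) where
  "f \<star> g = mu \<cdot> (f \<otimes>\<^sub>a g)"

definition into :: "'m set" where "into = {f \<in> Arr C. Cod C f = a}"

lemma into_iff [simp]: "f \<in> into \<longleftrightarrow> f \<in> Arr C \<and> Cod C f = a"
  by (simp add: into_def)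

lemma conv_arr [simp]:
  assumes "f \<in> Arr C" "Cod C f = a" "g \<in> Arr C" "Cod C g = a"
  shows "f \<star> g \<in> Arr C" "Dom C (f \<star> g) = Dom C f \<otimes>\<^sub>o Dom C g" "Cod C (f \<star> g) = a"
  using assms by (simp_all add: conv_def)

lemma conv_comp:
  assumes "f \<in> into" "g \<in> into" "u \<in> Arr C" "v \<in> Arr C" "Cod C u = Dom C f" "Cod C v = Dom C g"
  shows "(f \<star> g) \<cdot> (u \<otimes>\<^sub>a v) = (f \<cdot> u) \<star> (g \<cdot> v)"
  using assms by (simp add: conv_def comp_assoc_arr comp_tensor)

lemma conv_assoc:
  assumes "f \<in> into" "g \<in> into" "h \<in> into"
  shows "(f \<star> g) \<star> h = f \<star> (g \<star> h)"
proof -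
  have "(f \<star> g) \<star> h = mu \<cdot> ((mu \<otimes>\<^sub>a idn a) \<cdot> ((f \<otimes>\<^sub>a g) \<otimes>\<^sub>a h))"
    using assms by (simp add: conv_def comp_tensor)
  also have "\<dots> = (mu \<cdot> (idn a \<otimes>\<^sub>a mu)) \<cdot> (f \<otimes>\<^sub>a (g \<otimes>\<^sub>a h))"
    using assms by (simp add: algebra_laws(1)[symmetric] comp_assoc_arr tensor_arr_assoc)
  also have "\<dots> = f \<star> (g \<star> h)"
    using assms by (simp add: conv_def comp_assoc_arr comp_tensor)
  finally show ?thesis .
qed

lemma conv_unit_left:
  assumes "f \<in> into" shows "eta \<star> f = f"
proof -
  have "eta \<star> f = mu \<cdot> ((eta \<otimes>\<^sub>a idn a) \<cdot> (idn (unit C) \<otimes>\<^sub>a f))"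
    unfolding conv_def using assms by (subst comp_tensor) simp_all
  also have "\<dots> = (mu \<cdot> (eta \<otimes>\<^sub>a idn a)) \<cdot> f"
    using assms by (simp add: comp_assoc_arr)
  finally show ?thesis using assms by (simp add: algebra_laws)
qed

lemma conv_unit_right:
  assumes "f \<in> into" shows "f \<star> eta = f"
proof -
  have "f \<star> eta = mu \<cdot> ((idn a \<otimes>\<^sub>a eta) \<cdot> (f \<otimes>\<^sub>a idn (unit C)))"
    unfolding conv_def using assms by (subst comp_tensor) simp_all
  also have "\<dots> = (mu \<cdot> (idn a \<otimes>\<^sub>a eta)) \<cdot> f"
    using assms by (simp add: comp_assoc_arr)
  finally show ?thesis using assms by (simp add: algebra_laws)
qed

text \<open>
  A point of \<open>A\<close> has domain the tensor unit, so precomposition only affects the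
  other factor.
\<close>

lemma conv_point_left:
  assumes "\<alpha> \<in> into" "Dom C \<alpha> = unit C" "f \<in> into" "u \<in> Arr C" "Cod C u = Dom C f"
  shows "(\<alpha> \<star> f) \<cdot> u = \<alpha> \<star> (f \<cdot> u)"
  using conv_comp[of \<alpha> f "idn (unit C)" u] assms by simp

lemma conv_point_right:
  assumes "\<alpha> \<in> into" "Dom C \<alpha> = unit C" "f \<in> into" "u \<in> Arr C" "Cod C u = Dom C f"
  shows "(f \<star> \<alpha>) \<cdot> u = (f \<cdot> u) \<star> \<alpha>"
  using conv_comp[of f \<alpha> u "idn (unit C)"] assms by simp

lemma mu_eq_conv: "mu = idn a \<star> idn a"
  by (simp add: conv_def tensor_ident)

definition alg_hom :: "'m \<Rightarrow> bool" where
  "alg_hom \<phi> \<longleftrightarrow> \<phi> \<in> Hom C a a \<and> mu \<cdot> (\<phi> \<otimes>\<^sub>a \<phi>) = \<phi> \<cdot> mu \<and> \<phi> \<cdot> eta = eta"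

lemma alg_hom_arr [simp]:
  assumes "alg_hom \<phi>"
  shows "\<phi> \<in> Arr C" "Dom C \<phi> = a" "Cod C \<phi> = a"
  using assms by (auto simp: alg_hom_def)

lemma alg_hom_mul: "alg_hom \<phi> \<Longrightarrow> \<phi> \<star> \<phi> = \<phi> \<cdot> mu"
  and alg_hom_unit [simp]: "alg_hom \<phi> \<Longrightarrow> \<phi> \<cdot> eta = eta"
  unfolding alg_hom_def conv_def by blast+

lemma alg_hom_conv:
  assumes "alg_hom \<phi>" "f \<in> into" "g \<in> into"
  shows "\<phi> \<cdot> (f \<star> g) = (\<phi> \<cdot> f) \<star> (\<phi> \<cdot> g)"
proof -
  have "\<phi> \<cdot> (f \<star> g) = (\<phi> \<cdot> mu) \<cdot> (f \<otimes>\<^sub>a g)"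
    using assms by (simp add: conv_def comp_assoc_arr)
  also have "\<dots> = (\<phi> \<cdot> f) \<star> (\<phi> \<cdot> g)"
    using assms by (simp add: alg_hom_mul[symmetric] conv_comp)
  finally show ?thesis .
qed

lemma alg_homI:
  assumes "\<phi> \<in> Arr C" "Dom C \<phi> = a" "Cod C \<phi> = a" "\<phi> \<star> \<phi> = \<phi> \<cdot> mu" "\<phi> \<cdot> eta = eta"
  shows "alg_hom \<phi>"
  using assms unfolding alg_hom_def conv_def by simp

lemma alg_hom_id: "alg_hom (idn a)"
  by (rule alg_homI) (simp_all add: mu_eq_conv[symmetric])

lemma alg_hom_comp:
  assumes "alg_hom \<phi>" "alg_hom \<psi>"
  shows "alg_hom (\<phi> \<cdot> \<psi>)"
proof (rule alg_homI)
  show "\<phi> \<cdot> \<psi> \<in> Arr C" "Dom C (\<phi> \<cdot> \<psi>) = a" "Cod C (\<phi> \<cdot> \<psi>) = a" using assms by simp_all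
  have "(\<phi> \<cdot> \<psi>) \<star> (\<phi> \<cdot> \<psi>) = \<phi> \<cdot> (\<psi> \<star> \<psi>)" using assms by (simp add: alg_hom_conv)
  also have "\<psi> \<star> \<psi> = \<psi> \<cdot> mu" using assms by (simp add: alg_hom_mul)
  finally show "(\<phi> \<cdot> \<psi>) \<star> (\<phi> \<cdot> \<psi>) = \<phi> \<cdot> \<psi> \<cdot> mu" using assms by (simp add: comp_assoc_arr)
  show "\<phi> \<cdot> \<psi> \<cdot> eta = eta" using assms by (simp add: comp_assoc_arr)
qed

text \<open>
  An isomorphism in \<open>Aut(A)\<close> only comes with an inverse arrow of the ambient category;
  that this inverse is again multiplicative and unital makes \<open>Aut(A)\<close> closed under inverses.
\<close>

lemma alg_hom_inverse:
  assumes \<phi>: "alg_hom \<phi>" and \<psi>: "\<psi> \<in> Hom C a a"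
    and inv: "\<psi> \<cdot> \<phi> = idn a" "\<phi> \<cdot> \<psi> = idn a"
  shows "alg_hom \<psi>"
proof (rule alg_homI)
  show [simp]: "\<psi> \<in> Arr C" "Dom C \<psi> = a" "Cod C \<psi> = a" using \<psi> by simp_all
  have "\<psi> \<star> \<psi> = (\<psi> \<cdot> \<phi>) \<cdot> (\<psi> \<star> \<psi>)" by (simp add: inv)
  also have "\<dots> = \<psi> \<cdot> ((\<phi> \<cdot> \<psi>) \<star> (\<phi> \<cdot> \<psi>))" using \<phi> by (simp add: comp_assoc_arr alg_hom_conv)
  finally show "\<psi> \<star> \<psi> = \<psi> \<cdot> mu" by (simp add: inv mu_eq_conv[symmetric])
  have "\<psi> \<cdot> eta = \<psi> \<cdot> (\<phi> \<cdot> eta)" using \<phi> by simp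
  also have "\<dots> = (\<psi> \<cdot> \<phi>) \<cdot> eta" using \<phi> by (simp add: comp_assoc_arr del: alg_hom_unit)
  finally show "\<psi> \<cdot> eta = eta" by (simp add: inv)
qed

lemma Aut_carrier_iff:
  "\<phi> \<in> carrier (Aut C A) \<longleftrightarrow>
     alg_hom \<phi> \<and> (\<exists>\<psi>. alg_hom \<psi> \<and> \<psi> \<cdot> \<phi> = idn a \<and> \<phi> \<cdot> \<psi> = idn a)"
proof
  assume "\<phi> \<in> carrier (Aut C A)"
  then have \<phi>: "alg_hom \<phi>" and "is_iso C \<phi>"
    unfolding Aut_def alg_hom_def by simp_all
  then obtain \<psi> where "\<psi> \<in> Hom C a a" "\<psi> \<cdot> \<phi> = idn a" "\<phi> \<cdot> \<psi> = idn a"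
    by (auto simp: is_iso_def)
  with \<phi> alg_hom_inverse
  show "alg_hom \<phi> \<and> (\<exists>\<psi>. alg_hom \<psi> \<and> \<psi> \<cdot> \<phi> = idn a \<and> \<phi> \<cdot> \<psi> = idn a)" by blast
next
  assume *: "alg_hom \<phi> \<and> (\<exists>\<psi>. alg_hom \<psi> \<and> \<psi> \<cdot> \<phi> = idn a \<and> \<phi> \<cdot> \<psi> = idn a)"
  then have "is_iso C \<phi>" by (auto simp: is_iso_def)
  with * show "\<phi> \<in> carrier (Aut C A)" unfolding Aut_def alg_hom_def by simp
qed

lemma group_Aut: "group (Aut C A)"
proof (rule groupI)
  have [simp]: "\<phi> \<otimes>\<^bsub>Aut C A\<^esub> \<psi> = \<phi> \<cdot> \<psi>" "\<one>\<^bsub>Aut C A\<^esub> = idn a" for \<phi> \<psi>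
    by (simp_all add: Aut_def)
  show "\<one>\<^bsub>Aut C A\<^esub> \<in> carrier (Aut C A)"
    by (auto simp: Aut_carrier_iff alg_hom_id intro!: exI[of _ "idn a"])
  fix \<phi> assume \<phi>: "\<phi> \<in> carrier (Aut C A)"
  then have h\<phi>: "alg_hom \<phi>" by (simp add: Aut_carrier_iff)
  then show "\<one>\<^bsub>Aut C A\<^esub> \<otimes>\<^bsub>Aut C A\<^esub> \<phi> = \<phi>" by simp
  show "\<exists>\<psi>\<in>carrier (Aut C A). \<psi> \<otimes>\<^bsub>Aut C A\<^esub> \<phi> = \<one>\<^bsub>Aut C A\<^esub>"
    using \<phi> by (simp add: Aut_carrier_iff Bex_def) blast
  fix \<psi> assume \<psi>: "\<psi> \<in> carrier (Aut C A)"
  then have h\<psi>: "alg_hom \<psi>" by (simp add: Aut_carrier_iff)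
  obtain \<phi>' \<psi>' where inv: "alg_hom \<phi>'" "\<phi>' \<cdot> \<phi> = idn a" "\<phi> \<cdot> \<phi>' = idn a"
    "alg_hom \<psi>'" "\<psi>' \<cdot> \<psi> = idn a" "\<psi> \<cdot> \<psi>' = idn a"
    using \<phi> \<psi> by (auto simp: Aut_carrier_iff)
  have "\<psi>' \<cdot> \<phi>' \<cdot> (\<phi> \<cdot> \<psi>) = \<psi>' \<cdot> ((\<phi>' \<cdot> \<phi>) \<cdot> \<psi>)" "\<phi> \<cdot> \<psi> \<cdot> (\<psi>' \<cdot> \<phi>') = \<phi> \<cdot> ((\<psi> \<cdot> \<psi>') \<cdot> \<phi>')"
    using inv(1,4) h\<phi> h\<psi> by (simp_all add: comp_assoc_arr)
  then have "\<psi>' \<cdot> \<phi>' \<cdot> (\<phi> \<cdot> \<psi>) = idn a" "\<phi> \<cdot> \<psi> \<cdot> (\<psi>' \<cdot> \<phi>') = idn a"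
    using inv h\<psi> by simp_all
  then show "\<phi> \<otimes>\<^bsub>Aut C A\<^esub> \<psi> \<in> carrier (Aut C A)"
    using alg_hom_comp h\<phi> h\<psi> inv by (auto simp: Aut_carrier_iff)
  fix \<chi> assume "\<chi> \<in> carrier (Aut C A)"
  then have "alg_hom \<chi>" by (simp add: Aut_carrier_iff)
  then show "\<phi> \<otimes>\<^bsub>Aut C A\<^esub> \<psi> \<otimes>\<^bsub>Aut C A\<^esub> \<chi> = \<phi> \<otimes>\<^bsub>Aut C A\<^esub> (\<psi> \<otimes>\<^bsub>Aut C A\<^esub> \<chi>)"
    using h\<phi> h\<psi> by (simp add: comp_assoc_arr)
qed

lemma monoid_points: "monoid (points C A)"
proof -
  have [simp]: "\<alpha> \<otimes>\<^bsub>points C A\<^esub> \<beta> = \<alpha> \<star> \<beta>" "\<one>\<^bsub>points C A\<^esub> = eta"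
    "carrier (points C A) = Hom C (unit C) a" for \<alpha> \<beta>
    by (simp_all add: points_def conv_def)
  show ?thesis
    by (rule monoidI) (auto simp: Hom_def conv_assoc conv_unit_left conv_unit_right)
qed

lemma Units_points_iff:
  "\<alpha> \<in> Units (points C A) \<longleftrightarrow>
     \<alpha> \<in> Hom C (unit C) a \<and> (\<exists>\<beta>\<in>Hom C (unit C) a. \<beta> \<star> \<alpha> = eta \<and> \<alpha> \<star> \<beta> = eta)"
  by (simp add: Units_def points_def conv_def)

text \<open>
  Conjugation is a triple convolution product, which reduces its multiplicativity and the
  formula for its inverse to computations in a monoid.
\<close>

lemma inner_aut_eq:
  assumes \<alpha>: "\<alpha> \<in> Hom C (unit C) a" and \<beta>: "\<beta> \<in> Hom C (unit C) a"
    and inv: "\<beta> \<star> \<alpha> = eta" "\<alpha> \<star> \<beta> = eta"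
  shows "inner_aut C A \<alpha> = \<alpha> \<star> idn a \<star> \<beta>"
proof -
  have "inv\<^bsub>points C A\<^esub> \<alpha> = \<beta>"
    by (rule monoid.inv_char[OF monoid_points])
      (use assms in \<open>simp_all add: points_def conv_def\<close>)
  then have "inner_aut C A \<alpha> = mu \<cdot> ((mu \<otimes>\<^sub>a \<beta>) \<cdot> ((\<alpha> \<otimes>\<^sub>a idn a) \<otimes>\<^sub>a idn (unit C)))"
    using \<alpha> \<beta> by (simp add: inner_aut_def comp_assoc_arr)
  also have "\<dots> = \<alpha> \<star> idn a \<star> \<beta>"
    using \<alpha> \<beta> by (subst comp_tensor) (simp_all add: conv_def)
  finally show ?thesis .
qed



section \<open>Bimodules and splittings of bimodule idempotents\<close>

lemma bimodule_arr [simp]: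
  assumes "is_bimodule C A X"
  shows "bobj X \<in> Obj C"
    "lact X \<in> Arr C" "Dom C (lact X) = a \<otimes>\<^sub>o bobj X" "Cod C (lact X) = bobj X"
    "ract X \<in> Arr C" "Dom C (ract X) = bobj X \<otimes>\<^sub>o a" "Cod C (ract X) = bobj X"
  using assms unfolding is_bimodule_def by auto

lemma bimodule_laws:
  assumes "is_bimodule C A X"
  shows "lact X \<cdot> (mu \<otimes>\<^sub>a idn (bobj X)) = lact X \<cdot> (idn a \<otimes>\<^sub>a lact X)"
    "lact X \<cdot> (eta \<otimes>\<^sub>a idn (bobj X)) = idn (bobj X)"
    "ract X \<cdot> (idn (bobj X) \<otimes>\<^sub>a mu) = ract X \<cdot> (ract X \<otimes>\<^sub>a idn a)"
    "ract X \<cdot> (idn (bobj X) \<otimes>\<^sub>a eta) = idn (bobj X)"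
    "lact X \<cdot> (idn a \<otimes>\<^sub>a ract X) = ract X \<cdot> (lact X \<otimes>\<^sub>a idn a)"
  using assms unfolding is_bimodule_def by blast+

lemma bimodule_hom_arr:
  assumes "f \<in> bimodule_hom C A X Y"
  shows "f \<in> Arr C" "Dom C f = bobj X" "Cod C f = bobj Y"
  using assms unfolding bimodule_hom_def by auto

lemma bimodule_hom_laws:
  assumes "f \<in> bimodule_hom C A X Y"
  shows "f \<cdot> lact X = lact Y \<cdot> (idn a \<otimes>\<^sub>a f)" "f \<cdot> ract X = ract Y \<cdot> (f \<otimes>\<^sub>a idn a)"
  using assms unfolding bimodule_hom_def by blast+

lemma bimodule_homI:
  assumes "f \<in> Arr C" "Dom C f = bobj X" "Cod C f = bobj Y"
    "f \<cdot> lact X = lact Y \<cdot> (idn a \<otimes>\<^sub>a f)" "f \<cdot> ract X = ract Y \<cdot> (f \<otimes>\<^sub>a idn a)"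
  shows "f \<in> bimodule_hom C A X Y"
  using assms unfolding bimodule_hom_def by simp

lemma bimodule_hom_ident:
  "is_bimodule C A X \<Longrightarrow> idn (bobj X) \<in> bimodule_hom C A X X"
  by (rule bimodule_homI) (simp_all add: tensor_ident)

lemma bimodule_hom_comp:
  assumes X: "is_bimodule C A X" "is_bimodule C A Y" "is_bimodule C A Z"
    and f: "f \<in> bimodule_hom C A X Y" and g: "g \<in> bimodule_hom C A Y Z"
  shows "g \<cdot> f \<in> bimodule_hom C A X Z"
proof (rule bimodule_homI)
  note [simp] = bimodule_hom_arr[OF f] bimodule_hom_arr[OF g]
  have "g \<cdot> f \<cdot> lact X = (g \<cdot> lact Y) \<cdot> (idn a \<otimes>\<^sub>a f)"
    using f g X by (simp add: comp_assoc_arr bimodule_hom_laws(1)[OF f])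
  also have "\<dots> = lact Z \<cdot> (idn a \<otimes>\<^sub>a (g \<cdot> f))"
    using f g X by (simp add: comp_assoc_arr comp_tensor bimodule_hom_laws(1)[OF g])
  finally show "g \<cdot> f \<cdot> lact X = lact Z \<cdot> (idn a \<otimes>\<^sub>a (g \<cdot> f))" .
  have "g \<cdot> f \<cdot> ract X = (g \<cdot> ract Y) \<cdot> (f \<otimes>\<^sub>a idn a)"
    using f g X by (simp add: comp_assoc_arr bimodule_hom_laws(2)[OF f])
  also have "\<dots> = ract Z \<cdot> ((g \<cdot> f) \<otimes>\<^sub>a idn a)"
    using f g X by (simp add: comp_assoc_arr comp_tensor bimodule_hom_laws(2)[OF g])
  finally show "g \<cdot> f \<cdot> ract X = ract Z \<cdot> ((g \<cdot> f) \<otimes>\<^sub>a idn a)" .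
qed (use bimodule_hom_arr[OF f] bimodule_hom_arr[OF g] in simp_all)

lemma bimodule_iso_refl: "is_bimodule C A X \<Longrightarrow> bimodule_iso C A X X"
  unfolding bimodule_iso_def using bimodule_hom_ident[of X] by (auto intro!: bexI[of _ "idn (bobj X)"])

lemma bimodule_iso_sym: "bimodule_iso C A X Y \<Longrightarrow> bimodule_iso C A Y X"
  unfolding bimodule_iso_def by blast

lemma comp_inverses:
  assumes "f \<in> Hom C U V" "f' \<in> Hom C V U" "g \<in> Hom C V W" "g' \<in> Hom C W V"
    and "f' \<cdot> f = ident C U" "g' \<cdot> g = ident C V"
  shows "f' \<cdot> g' \<cdot> (g \<cdot> f) = ident C U"
proof -
  have "f' \<cdot> g' \<cdot> (g \<cdot> f) = f' \<cdot> ((g' \<cdot> g) \<cdot> f)" using assms(1-4) by (simp add: comp_assoc_arr)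
  then show ?thesis using assms by simp
qed

lemma bimodule_iso_trans:
  assumes X: "is_bimodule C A X" "is_bimodule C A Y" "is_bimodule C A Z"
    and "bimodule_iso C A X Y" "bimodule_iso C A Y Z"
  shows "bimodule_iso C A X Z"
proof -
  obtain f f' g g' where f: "f \<in> bimodule_hom C A X Y" and f': "f' \<in> bimodule_hom C A Y X"
    and g: "g \<in> bimodule_hom C A Y Z" and g': "g' \<in> bimodule_hom C A Z Y"
    and inv: "f' \<cdot> f = idn (bobj X)" "f \<cdot> f' = idn (bobj Y)"
      "g' \<cdot> g = idn (bobj Y)" "g \<cdot> g' = idn (bobj Z)"
    using assms unfolding bimodule_iso_def by blast
  note [simp] = bimodule_hom_arr[OF f] bimodule_hom_arr[OF f'] bimodule_hom_arr[OF g]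
    bimodule_hom_arr[OF g']
  have "g \<cdot> f \<in> bimodule_hom C A X Z" "f' \<cdot> g' \<in> bimodule_hom C A Z X"
    using X f f' g g' bimodule_hom_comp by blast+
  moreover have "f' \<cdot> g' \<cdot> (g \<cdot> f) = idn (bobj X)"
    by (rule comp_inverses[where V = "bobj Y" and W = "bobj Z"]) (use inv in simp_all)
  moreover have "g \<cdot> f \<cdot> (f' \<cdot> g') = idn (bobj Z)"
    by (rule comp_inverses[where V = "bobj Y" and W = "bobj X"]) (use inv in simp_all)
  ultimately show ?thesis unfolding bimodule_iso_def by blast
qed

text \<open>
  Since \<open>id \<otimes> p\<close> is split by \<open>id \<otimes> s\<close>, the action of \<open>Z\<close> is \<open>p\<close> after the action of \<open>M\<close>
  after \<open>id \<otimes> s\<close>; linearity of \<open>s\<close> then reduces to linearity of the projector \<open>s \<cdot> p\<close>.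
\<close>

lemma section_bimodule_hom:
  assumes M: "is_bimodule C A M" and Z: "is_bimodule C A Z"
    and p: "p \<in> bimodule_hom C A M Z" and s: "s \<in> Hom C (bobj Z) (bobj M)"
    and ps: "p \<cdot> s = idn (bobj Z)" and sp: "s \<cdot> p \<in> bimodule_hom C A M M"
  shows "s \<in> bimodule_hom C A Z M"
proof (rule bimodule_homI)
  note [simp] = bimodule_arr[OF M] bimodule_arr[OF Z] bimodule_hom_arr[OF p]
  show [simp]: "s \<in> Arr C" "Dom C s = bobj Z" "Cod C s = bobj M" using s by simp_all
  have sps: "s \<cdot> (p \<cdot> s) = s" by (simp add: ps)
  have "s \<cdot> lact Z = s \<cdot> (lact Z \<cdot> ((idn a \<otimes>\<^sub>a p) \<cdot> (idn a \<otimes>\<^sub>a s)))"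
    by (simp add: comp_tensor ps tensor_ident)
  also have "\<dots> = s \<cdot> ((lact Z \<cdot> (idn a \<otimes>\<^sub>a p)) \<cdot> (idn a \<otimes>\<^sub>a s))"
    by (simp add: comp_assoc_arr)
  also have "\<dots> = ((s \<cdot> p) \<cdot> lact M) \<cdot> (idn a \<otimes>\<^sub>a s)"
    by (simp add: comp_assoc_arr flip: bimodule_hom_laws(1)[OF p])
  also have "\<dots> = lact M \<cdot> (idn a \<otimes>\<^sub>a s)"
    by (simp add: bimodule_hom_laws(1)[OF sp] comp_assoc_arr comp_tensor sps)
  finally show "s \<cdot> lact Z = lact M \<cdot> (idn a \<otimes>\<^sub>a s)" .
  have "s \<cdot> ract Z = s \<cdot> (ract Z \<cdot> ((p \<otimes>\<^sub>a idn a) \<cdot> (s \<otimes>\<^sub>a idn a)))"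
    by (simp add: comp_tensor ps tensor_ident)
  also have "\<dots> = s \<cdot> ((ract Z \<cdot> (p \<otimes>\<^sub>a idn a)) \<cdot> (s \<otimes>\<^sub>a idn a))"
    by (simp add: comp_assoc_arr)
  also have "\<dots> = ((s \<cdot> p) \<cdot> ract M) \<cdot> (s \<otimes>\<^sub>a idn a)"
    by (simp add: comp_assoc_arr flip: bimodule_hom_laws(2)[OF p])
  also have "\<dots> = ract M \<cdot> (s \<otimes>\<^sub>a idn a)"
    by (simp add: bimodule_hom_laws(2)[OF sp] comp_assoc_arr comp_tensor sps)
  finally show "s \<cdot> ract Z = ract M \<cdot> (s \<otimes>\<^sub>a idn a)" .
qed

text \<open>
  \<open>Z\<close> is the image of the idempotent \<open>P\<close> of \<open>M\<close>, in the category of bimodules.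
\<close>

definition splits ::
    "('o, 'm) bimodule_data \<Rightarrow> 'm \<Rightarrow> ('o, 'm) bimodule_data \<Rightarrow> 'm \<Rightarrow> 'm \<Rightarrow> bool" where
  "splits M P Z p s \<longleftrightarrow> p \<in> bimodule_hom C A M Z \<and> s \<in> bimodule_hom C A Z M \<and>
     p \<cdot> s = idn (bobj Z) \<and> s \<cdot> p = P"

text \<open>
  Taking the two splittings in either order yields mutually inverse isomorphisms, hence
  the uniqueness of splittings below.
\<close>

lemma splits_comp_id:
  assumes M: "is_bimodule C A M" "is_bimodule C A Z" "is_bimodule C A Z'"
    and "splits M P Z p s" "splits M P Z' p' s'"
  shows "p' \<cdot> s \<in> bimodule_hom C A Z Z'" "(p \<cdot> s') \<cdot> (p' \<cdot> s) = idn (bobj Z)"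
proof -
  have p: "p \<in> bimodule_hom C A M Z" and s: "s \<in> bimodule_hom C A Z M"
    and p': "p' \<in> bimodule_hom C A M Z'" and s': "s' \<in> bimodule_hom C A Z' M"
    and ps: "p \<cdot> s = idn (bobj Z)" and eq: "s' \<cdot> p' = s \<cdot> p"
    using assms by (auto simp: splits_def)
  note [simp] = bimodule_hom_arr[OF p] bimodule_hom_arr[OF p'] bimodule_hom_arr[OF s]
    bimodule_hom_arr[OF s']
  show "p' \<cdot> s \<in> bimodule_hom C A Z Z'" using M p' s bimodule_hom_comp by blast
  have "(p \<cdot> s') \<cdot> (p' \<cdot> s) = p \<cdot> ((s' \<cdot> p') \<cdot> s)"
    by (simp add: comp_assoc_arr)
  also have "\<dots> = (p \<cdot> s) \<cdot> (p \<cdot> s)" by (simp add: eq comp_assoc_arr)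
  finally show "(p \<cdot> s') \<cdot> (p' \<cdot> s) = idn (bobj Z)" using M by (simp add: ps)
qed

lemma splits_unique:
  assumes "is_bimodule C A M" "is_bimodule C A Z" "is_bimodule C A Z'"
    and "splits M P Z p s" "splits M P Z' p' s'"
  shows "bimodule_iso C A Z Z'"
  unfolding bimodule_iso_def
  using splits_comp_id[OF assms] splits_comp_id[OF assms(1,3,2,5,4)] by blast

lemma splits_transport:
  assumes M: "is_bimodule C A M" "is_bimodule C A M'" "is_bimodule C A Z"
    and "splits M' P' Z p s"
    and i: "i \<in> bimodule_hom C A M M'" and j: "j \<in> bimodule_hom C A M' M"
    and P: "i \<cdot> P = P' \<cdot> i" "P \<in> Arr C" "Dom C P = bobj M" "Cod C P = bobj M"
    and ij: "i \<cdot> j = idn (bobj M')" "j \<cdot> i = idn (bobj M)"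
  shows "splits M P Z (p \<cdot> i) (j \<cdot> s)"
proof -
  have p: "p \<in> bimodule_hom C A M' Z" and s: "s \<in> bimodule_hom C A Z M'"
    and ps: "p \<cdot> s = idn (bobj Z)" and sp: "s \<cdot> p = P'"
    using assms by (auto simp: splits_def)
  note [simp] = bimodule_hom_arr[OF p] bimodule_hom_arr[OF s] bimodule_hom_arr[OF i]
    bimodule_hom_arr[OF j] M P(2,3,4)
  have "p \<cdot> i \<cdot> (j \<cdot> s) = p \<cdot> ((i \<cdot> j) \<cdot> s)" by (simp add: comp_assoc_arr)
  then have 1: "p \<cdot> i \<cdot> (j \<cdot> s) = idn (bobj Z)" by (simp add: ij ps)
  have "j \<cdot> s \<cdot> (p \<cdot> i) = j \<cdot> ((s \<cdot> p) \<cdot> i)" by (simp add: comp_assoc_arr)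
  also have "\<dots> = (j \<cdot> i) \<cdot> P" by (simp add: sp P(1)[symmetric] comp_assoc_arr)
  finally have 2: "j \<cdot> s \<cdot> (p \<cdot> i) = P" by (simp add: ij)
  show ?thesis
    unfolding splits_def using 1 2 p s i j M bimodule_hom_comp by blast
qed

text \<open>
  An idempotent bimodule endomorphism that splits on underlying objects splits as a
  bimodule: the actions of \<open>M\<close> are transported to \<open>V\<close> by sandwiching between \<open>e\<close> and \<open>r\<close>, and
  \<open>e\<close> becomes linear. As \<open>e\<close> is monic, the module laws for \<open>V\<close> follow from those for \<open>M\<close>.
\<close>

lemma idempotent_bimodule_splits:
  assumes M: "is_bimodule C A M" and P: "P \<in> bimodule_hom C A M M"
    and e: "e \<in> Hom C V (bobj M)" and r: "r \<in> Hom C (bobj M) V"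
    and re: "r \<cdot> e = idn V" and er: "e \<cdot> r = P"
  shows "\<exists>Z. is_bimodule C A Z \<and> splits M P Z r e"
proof -
  have V [simp]: "V \<in> Obj C" using Hom_Obj[OF e] by simp
  note [simp] = bimodule_arr[OF M] bimodule_hom_arr[OF P]
  have [simp]: "e \<in> Arr C" "Dom C e = V" "Cod C e = bobj M"
    "r \<in> Arr C" "Dom C r = bobj M" "Cod C r = V" using e r by simp_all
  define Z :: "('o, 'm) bimodule_data" where
    "Z = \<lparr>bobj = V, lact = r \<cdot> (lact M \<cdot> (idn a \<otimes>\<^sub>a e)), ract = r \<cdot> (ract M \<cdot> (e \<otimes>\<^sub>a idn a))\<rparr>"
  have Z [simp]: "bobj Z = V" "lact Z = r \<cdot> (lact M \<cdot> (idn a \<otimes>\<^sub>a e))"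
    "ract Z = r \<cdot> (ract M \<cdot> (e \<otimes>\<^sub>a idn a))" by (simp_all add: Z_def)
  have rP: "r \<cdot> (e \<cdot> r) = r" using re by (simp flip: comp_assoc_arr)
  have Pe: "P \<cdot> e = e" using re by (simp add: comp_assoc_arr flip: er)
  have rP': "r \<cdot> P = r" using rP er by simp
  have r_l: "r \<cdot> lact M = lact Z \<cdot> (idn a \<otimes>\<^sub>a r)"
  proof -
    have "lact Z \<cdot> (idn a \<otimes>\<^sub>a r) = r \<cdot> (lact M \<cdot> (idn a \<otimes>\<^sub>a P))"
      by (simp add: comp_assoc_arr comp_tensor er)
    also have "\<dots> = (r \<cdot> P) \<cdot> lact M" by (simp add: comp_assoc_arr bimodule_hom_laws(1)[OF P])
    finally show ?thesis by (simp add: rP')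
  qed
  have r_r: "r \<cdot> ract M = ract Z \<cdot> (r \<otimes>\<^sub>a idn a)"
  proof -
    have "ract Z \<cdot> (r \<otimes>\<^sub>a idn a) = r \<cdot> (ract M \<cdot> (P \<otimes>\<^sub>a idn a))"
      by (simp add: comp_assoc_arr comp_tensor er)
    also have "\<dots> = (r \<cdot> P) \<cdot> ract M" by (simp add: comp_assoc_arr bimodule_hom_laws(2)[OF P])
    finally show ?thesis by (simp add: rP')
  qed
  have e_l: "e \<cdot> lact Z = lact M \<cdot> (idn a \<otimes>\<^sub>a e)"
  proof -
    have "e \<cdot> lact Z = ((e \<cdot> r) \<cdot> lact M) \<cdot> (idn a \<otimes>\<^sub>a e)" by (simp add: comp_assoc_arr)
    also have "\<dots> = lact M \<cdot> (idn a \<otimes>\<^sub>a (P \<cdot> e))"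
      by (simp add: er bimodule_hom_laws(1)[OF P] comp_assoc_arr comp_tensor)
    finally show ?thesis by (simp add: Pe)
  qed
  have e_r: "e \<cdot> ract Z = ract M \<cdot> (e \<otimes>\<^sub>a idn a)"
  proof -
    have "e \<cdot> ract Z = ((e \<cdot> r) \<cdot> ract M) \<cdot> (e \<otimes>\<^sub>a idn a)" by (simp add: comp_assoc_arr)
    also have "\<dots> = ract M \<cdot> ((P \<cdot> e) \<otimes>\<^sub>a idn a)"
      by (simp add: er bimodule_hom_laws(2)[OF P] comp_assoc_arr comp_tensor)
    finally show ?thesis by (simp add: Pe)
  qed
  have Zarr: "lact Z \<in> Hom C (a \<otimes>\<^sub>o V) V" "ract Z \<in> Hom C (V \<otimes>\<^sub>o a) V" by simp_all
  \<comment> \<open>The section \<open>e\<close> is monic, and \<open>el\<close>, \<open>er'\<close> below push it through the actions of \<open>Z\<close>.\<close>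
  have mono: "f = g" if "f \<in> Hom C W V" "g \<in> Hom C W V" "e \<cdot> f = e \<cdot> g" for W f g
  proof -
    have "(r \<cdot> e) \<cdot> f = (r \<cdot> e) \<cdot> g" using that by (simp add: comp_assoc_arr)
    then show ?thesis using that by (simp add: re)
  qed
  have "is_bimodule C A Z"
  proof -
    let ?l = "lact Z" and ?r = "ract Z"
    note lZ = Zarr[simplified Hom_iff] 
    have el: "e \<cdot> (?l \<cdot> u) = lact M \<cdot> ((idn a \<otimes>\<^sub>a e) \<cdot> u)"
      if "u \<in> Arr C" "Cod C u = a \<otimes>\<^sub>o V" for u
    proof -
      have "e \<cdot> (?l \<cdot> u) = (e \<cdot> ?l) \<cdot> u" using that lZ by (simp add: comp_assoc_arr del: Z)
      then show ?thesis using that lZ unfolding e_l by (simp add: comp_assoc_arr)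
    qed
    have er': "e \<cdot> (?r \<cdot> u) = ract M \<cdot> ((e \<otimes>\<^sub>a idn a) \<cdot> u)"
      if "u \<in> Arr C" "Cod C u = V \<otimes>\<^sub>o a" for u
    proof -
      have "e \<cdot> (?r \<cdot> u) = (e \<cdot> ?r) \<cdot> u" using that lZ by (simp add: comp_assoc_arr del: Z)
      then show ?thesis using that lZ unfolding e_r by (simp add: comp_assoc_arr)
    qed
    note [simp] = lZ
    note [simp del] = Z(2,3)
    have ll: "?l \<cdot> (mu \<otimes>\<^sub>a idn V) = ?l \<cdot> (idn a \<otimes>\<^sub>a ?l)"
    proof (rule mono)
      have "e \<cdot> (?l \<cdot> (mu \<otimes>\<^sub>a idn V)) = lact M \<cdot> ((mu \<otimes>\<^sub>a idn (bobj M)) \<cdot> ((idn a \<otimes>\<^sub>a idn a) \<otimes>\<^sub>a e))"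
        by (simp add: el comp_tensor tensor_ident)
      also have "\<dots> = (lact M \<cdot> (mu \<otimes>\<^sub>a idn (bobj M))) \<cdot> (idn a \<otimes>\<^sub>a (idn a \<otimes>\<^sub>a e))"
        by (simp add: comp_assoc_arr tensor_arr_assoc)
      also have "\<dots> = e \<cdot> (?l \<cdot> (idn a \<otimes>\<^sub>a ?l))"
        by (simp add: bimodule_laws(1)[OF M] el comp_assoc_arr comp_tensor e_l)
      finally show "e \<cdot> (?l \<cdot> (mu \<otimes>\<^sub>a idn V)) = e \<cdot> (?l \<cdot> (idn a \<otimes>\<^sub>a ?l))" .
    qed simp_all
    have rr: "?r \<cdot> (idn V \<otimes>\<^sub>a mu) = ?r \<cdot> (?r \<otimes>\<^sub>a idn a)"
    proof (rule mono)
      have "e \<cdot> (?r \<cdot> (idn V \<otimes>\<^sub>a mu)) = ract M \<cdot> ((idn (bobj M) \<otimes>\<^sub>a mu) \<cdot> (e \<otimes>\<^sub>a (idn a \<otimes>\<^sub>a idn a)))"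
        by (simp add: er' comp_tensor tensor_ident)
      also have "\<dots> = (ract M \<cdot> (idn (bobj M) \<otimes>\<^sub>a mu)) \<cdot> ((e \<otimes>\<^sub>a idn a) \<otimes>\<^sub>a idn a)"
        by (simp add: comp_assoc_arr tensor_arr_assoc)
      also have "\<dots> = e \<cdot> (?r \<cdot> (?r \<otimes>\<^sub>a idn a))"
        by (simp add: bimodule_laws(3)[OF M] er' comp_assoc_arr comp_tensor e_r)
      finally show "e \<cdot> (?r \<cdot> (idn V \<otimes>\<^sub>a mu)) = e \<cdot> (?r \<cdot> (?r \<otimes>\<^sub>a idn a))" .
    qed simp_all
    have lr: "?l \<cdot> (idn a \<otimes>\<^sub>a ?r) = ?r \<cdot> (?l \<otimes>\<^sub>a idn a)"
    proof (rule mono)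
      have "e \<cdot> (?l \<cdot> (idn a \<otimes>\<^sub>a ?r))
          = (lact M \<cdot> (idn a \<otimes>\<^sub>a ract M)) \<cdot> (idn a \<otimes>\<^sub>a (e \<otimes>\<^sub>a idn a))"
        by (simp add: el comp_assoc_arr comp_tensor e_r)
      also have "\<dots> = (ract M \<cdot> (lact M \<otimes>\<^sub>a idn a)) \<cdot> ((idn a \<otimes>\<^sub>a e) \<otimes>\<^sub>a idn a)"
        by (simp add: bimodule_laws(5)[OF M] tensor_arr_assoc)
      also have "\<dots> = e \<cdot> (?r \<cdot> (?l \<otimes>\<^sub>a idn a))"
        by (simp add: er' comp_assoc_arr comp_tensor e_l)
      finally show "e \<cdot> (?l \<cdot> (idn a \<otimes>\<^sub>a ?r)) = e \<cdot> (?r \<cdot> (?l \<otimes>\<^sub>a idn a))" .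
    qed simp_all
    have lu: "?l \<cdot> (eta \<otimes>\<^sub>a idn V) = idn V"
    proof (rule mono)
      have "e \<cdot> (?l \<cdot> (eta \<otimes>\<^sub>a idn V))
          = lact M \<cdot> ((eta \<otimes>\<^sub>a idn (bobj M)) \<cdot> (idn (unit C) \<otimes>\<^sub>a e))"
        by (subst comp_tensor) (simp_all add: el comp_tensor)
      also have "\<dots> = (lact M \<cdot> (eta \<otimes>\<^sub>a idn (bobj M))) \<cdot> e" by (simp add: comp_assoc_arr)
      finally show "e \<cdot> (?l \<cdot> (eta \<otimes>\<^sub>a idn V)) = e \<cdot> idn V"
        by (simp add: bimodule_laws(2)[OF M])
    qed simp_all
    have ru: "?r \<cdot> (idn V \<otimes>\<^sub>a eta) = idn V"
    proof (rule mono)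
      have "e \<cdot> (?r \<cdot> (idn V \<otimes>\<^sub>a eta))
          = ract M \<cdot> ((idn (bobj M) \<otimes>\<^sub>a eta) \<cdot> (e \<otimes>\<^sub>a idn (unit C)))"
        by (subst comp_tensor) (simp_all add: er' comp_tensor)
      also have "\<dots> = (ract M \<cdot> (idn (bobj M) \<otimes>\<^sub>a eta)) \<cdot> e" by (simp add: comp_assoc_arr)
      finally show "e \<cdot> (?r \<cdot> (idn V \<otimes>\<^sub>a eta)) = e \<cdot> idn V"
        by (simp add: bimodule_laws(4)[OF M])
    qed simp_all
    show ?thesis unfolding is_bimodule_def using ll rr lr lu ru by simp
  qed
  moreover have "splits M P Z r e"
    unfolding splits_def
    by (intro conjI bimodule_homI) (use r_l r_r e_l e_r re er in \<open>simp_all del: Z(2,3)\<close>)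
  ultimately show ?thesis by blast
qed



section \<open>The outer tensor product of bimodules\<close>

text \<open>
  The bimodule structure on \<open>X \<otimes> Y\<close> with \<open>A\<close> acting on the outer sides only. Relative tensor
  products are images of this bimodule, and it is strictly associative.
\<close>

definition outer ::
    "('o, 'm) bimodule_data \<Rightarrow> ('o, 'm) bimodule_data \<Rightarrow> ('o, 'm) bimodule_data"
    (infixl "\<boxtimes>" 70) where
  "X \<boxtimes> Y = \<lparr>bobj = bobj X \<otimes>\<^sub>o bobj Y,
            lact = lact X \<otimes>\<^sub>a idn (bobj Y), ract = idn (bobj X) \<otimes>\<^sub>a ract Y\<rparr>"

lemma outer_sel [simp]:
  "bobj (X \<boxtimes> Y) = bobj X \<otimes>\<^sub>o bobj Y"
  "lact (X \<boxtimes> Y) = lact X \<otimes>\<^sub>a idn (bobj Y)"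
  "ract (X \<boxtimes> Y) = idn (bobj X) \<otimes>\<^sub>a ract Y"
  by (simp_all add: outer_def)

lemma outer_bimodule:
  assumes X: "is_bimodule C A X" and Y: "is_bimodule C A Y"
  shows "is_bimodule C A (X \<boxtimes> Y)"
proof -
  let ?X = "idn (bobj X)" and ?Y = "idn (bobj Y)"
  note [simp] = bimodule_arr[OF X] bimodule_arr[OF Y]
  have "(lact X \<otimes>\<^sub>a ?Y) \<cdot> (mu \<otimes>\<^sub>a idn (bobj X \<otimes>\<^sub>o bobj Y))
      = (lact X \<otimes>\<^sub>a ?Y) \<cdot> ((mu \<otimes>\<^sub>a ?X) \<otimes>\<^sub>a ?Y)"
    by (simp add: tensor_arr_assoc tensor_ident)
  also have "\<dots> = (lact X \<otimes>\<^sub>a ?Y) \<cdot> (idn a \<otimes>\<^sub>a (lact X \<otimes>\<^sub>a ?Y))"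
    by (simp add: comp_tensor bimodule_laws(1)[OF X] flip: tensor_arr_assoc)
  finally have 1: "(lact X \<otimes>\<^sub>a ?Y) \<cdot> (mu \<otimes>\<^sub>a idn (bobj X \<otimes>\<^sub>o bobj Y))
      = (lact X \<otimes>\<^sub>a ?Y) \<cdot> (idn a \<otimes>\<^sub>a (lact X \<otimes>\<^sub>a ?Y))" .
  have "(lact X \<otimes>\<^sub>a ?Y) \<cdot> (eta \<otimes>\<^sub>a idn (bobj X \<otimes>\<^sub>o bobj Y))
      = (lact X \<otimes>\<^sub>a ?Y) \<cdot> ((eta \<otimes>\<^sub>a ?X) \<otimes>\<^sub>a ?Y)"
    by (simp add: tensor_arr_assoc tensor_ident)
  then have 2: "(lact X \<otimes>\<^sub>a ?Y) \<cdot> (eta \<otimes>\<^sub>a idn (bobj X \<otimes>\<^sub>o bobj Y)) = idn (bobj X \<otimes>\<^sub>o bobj Y)"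
    by (simp add: comp_tensor bimodule_laws(2)[OF X] tensor_ident)
  have "(?X \<otimes>\<^sub>a ract Y) \<cdot> (idn (bobj X \<otimes>\<^sub>o bobj Y) \<otimes>\<^sub>a mu)
      = (?X \<otimes>\<^sub>a ract Y) \<cdot> (?X \<otimes>\<^sub>a (?Y \<otimes>\<^sub>a mu))"
    by (simp flip: tensor_arr_assoc tensor_ident)
  also have "\<dots> = (?X \<otimes>\<^sub>a ract Y) \<cdot> ((?X \<otimes>\<^sub>a ract Y) \<otimes>\<^sub>a idn a)"
    by (simp add: comp_tensor bimodule_laws(3)[OF Y] tensor_arr_assoc)
  finally have 3: "(?X \<otimes>\<^sub>a ract Y) \<cdot> (idn (bobj X \<otimes>\<^sub>o bobj Y) \<otimes>\<^sub>a mu)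
      = (?X \<otimes>\<^sub>a ract Y) \<cdot> ((?X \<otimes>\<^sub>a ract Y) \<otimes>\<^sub>a idn a)" .
  have "(?X \<otimes>\<^sub>a ract Y) \<cdot> (idn (bobj X \<otimes>\<^sub>o bobj Y) \<otimes>\<^sub>a eta)
      = (?X \<otimes>\<^sub>a ract Y) \<cdot> (?X \<otimes>\<^sub>a (?Y \<otimes>\<^sub>a eta))"
    by (simp flip: tensor_arr_assoc tensor_ident)
  then have 4: "(?X \<otimes>\<^sub>a ract Y) \<cdot> (idn (bobj X \<otimes>\<^sub>o bobj Y) \<otimes>\<^sub>a eta) = idn (bobj X \<otimes>\<^sub>o bobj Y)"
    by (simp add: comp_tensor bimodule_laws(4)[OF Y] tensor_ident)
  have "(lact X \<otimes>\<^sub>a ?Y) \<cdot> (idn a \<otimes>\<^sub>a (?X \<otimes>\<^sub>a ract Y))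
      = (lact X \<otimes>\<^sub>a ?Y) \<cdot> (idn (a \<otimes>\<^sub>o bobj X) \<otimes>\<^sub>a ract Y)"
    by (simp add: tensor_ident flip: tensor_arr_assoc)
  also have "\<dots> = (?X \<otimes>\<^sub>a ract Y) \<cdot> (lact X \<otimes>\<^sub>a idn (bobj Y \<otimes>\<^sub>o a))"
    by (simp add: comp_tensor)
  also have "\<dots> = (?X \<otimes>\<^sub>a ract Y) \<cdot> ((lact X \<otimes>\<^sub>a ?Y) \<otimes>\<^sub>a idn a)"
    by (simp add: tensor_arr_assoc tensor_ident)
  finally have 5: "(lact X \<otimes>\<^sub>a ?Y) \<cdot> (idn a \<otimes>\<^sub>a (?X \<otimes>\<^sub>a ract Y))
      = (?X \<otimes>\<^sub>a ract Y) \<cdot> ((lact X \<otimes>\<^sub>a ?Y) \<otimes>\<^sub>a idn a)" .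
  show ?thesis unfolding is_bimodule_def outer_sel using 1 2 3 4 5 by simp
qed

lemma outer_assoc:
  assumes "is_bimodule C A X" "is_bimodule C A Y" "is_bimodule C A Z"
  shows "(X \<boxtimes> Y) \<boxtimes> Z = X \<boxtimes> (Y \<boxtimes> Z)"
proof -
  have "idn (bobj X \<otimes>\<^sub>o bobj Y) \<otimes>\<^sub>a ract Z = idn (bobj X) \<otimes>\<^sub>a (idn (bobj Y) \<otimes>\<^sub>a ract Z)"
    using assms by (simp flip: tensor_arr_assoc tensor_ident)
  then show ?thesis using assms by (simp add: outer_def tensor_arr_assoc tensor_ident)
qed

lemma outer_hom:
  assumes X: "is_bimodule C A X" "is_bimodule C A X'" "is_bimodule C A Y" "is_bimodule C A Y'"
    and f: "f \<in> bimodule_hom C A X X'" and g: "g \<in> bimodule_hom C A Y Y'"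
  shows "f \<otimes>\<^sub>a g \<in> bimodule_hom C A (X \<boxtimes> Y) (X' \<boxtimes> Y')"
proof (rule bimodule_homI)
  note [simp] = bimodule_hom_arr[OF f] bimodule_hom_arr[OF g] X
  show "(f \<otimes>\<^sub>a g) \<cdot> lact (X \<boxtimes> Y) = lact (X' \<boxtimes> Y') \<cdot> (idn a \<otimes>\<^sub>a (f \<otimes>\<^sub>a g))"
    by (simp add: comp_tensor bimodule_hom_laws(1)[OF f] flip: tensor_arr_assoc)
  show "(f \<otimes>\<^sub>a g) \<cdot> ract (X \<boxtimes> Y) = ract (X' \<boxtimes> Y') \<cdot> ((f \<otimes>\<^sub>a g) \<otimes>\<^sub>a idn a)"
    by (simp add: comp_tensor bimodule_hom_laws(2)[OF g] tensor_arr_assoc)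
qed (simp_all add: bimodule_hom_arr[OF f] bimodule_hom_arr[OF g])

abbreviation reg :: "('o, 'm) bimodule_data" where "reg \<equiv> regular_bimodule A"

lemma reg_sel [simp]: "bobj reg = a" "lact reg = mu" "ract reg = mu"
  by (simp_all add: regular_bimodule_def)

lemma reg_bimodule: "is_bimodule C A reg"
  unfolding is_bimodule_def by (simp add: algebra_laws)

text \<open>
  The actions themselves are bimodule arrows out of an outer tensor product with \<open>A\<close>, so
  compatibility with an action becomes an instance of naturality.
\<close>

lemma lact_hom:
  assumes X: "is_bimodule C A X"
  shows "lact X \<in> bimodule_hom C A (reg \<boxtimes> X) X"
  by (rule bimodule_homI)
    (use X in \<open>simp_all add: bimodule_laws(1)[OF X] bimodule_laws(5)[OF X]\<close>)

lemma ract_hom: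
  assumes X: "is_bimodule C A X"
  shows "ract X \<in> bimodule_hom C A (X \<boxtimes> reg) X"
  by (rule bimodule_homI)
    (use X in \<open>simp_all add: bimodule_laws(3)[OF X] bimodule_laws(5)[OF X]\<close>)

definition balanced :: "('o, 'm) bimodule_data \<Rightarrow> ('o, 'm) bimodule_data \<Rightarrow> 'm \<Rightarrow> bool" where
  "balanced X Y h \<longleftrightarrow> h \<in> Arr C \<and> Dom C h = bobj X \<otimes>\<^sub>o bobj Y \<and>
     h \<cdot> (ract X \<otimes>\<^sub>a idn (bobj Y)) = h \<cdot> (idn (bobj X) \<otimes>\<^sub>a lact Y)"

text \<open>
  A split form of the coequalizer condition. The section may be any arrow of the ambient
  category: for \<open>A \<otimes>\<^sub>A X\<close> and for twisted regular bimodules it inserts the unit of \<open>A\<close> and need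
  not be linear.
\<close>

lemma tensor_overI:
  assumes X: "is_bimodule C A X" and Y: "is_bimodule C A Y" and Z: "is_bimodule C A Z"
    and p: "p \<in> bimodule_hom C A (X \<boxtimes> Y) Z" and bal: "balanced X Y p"
    and s: "s \<in> Hom C (bobj Z) (bobj X \<otimes>\<^sub>o bobj Y)" and ps: "p \<cdot> s = idn (bobj Z)"
    and absorb: "\<And>h. balanced X Y h \<Longrightarrow> h \<cdot> (s \<cdot> p) = h"
  shows "is_tensor_over C A X Y Z"
proof -
  note [simp] = X Y Z
  have pa: "p \<in> Hom C (bobj X \<otimes>\<^sub>o bobj Y) (bobj Z)"
    using bimodule_hom_arr[OF p] by simp
  have "is_coequalizer C (ract X \<otimes>\<^sub>a idn (bobj Y)) (idn (bobj X) \<otimes>\<^sub>a lact Y) p"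
    by (rule split_coequalizer[where s = s and V = "bobj X \<otimes>\<^sub>o bobj Y"
            and U = "bobj X \<otimes>\<^sub>o (a \<otimes>\<^sub>o bobj Y)" and W = "bobj Z"])
      (use pa bal s ps absorb in \<open>simp_all add: balanced_def\<close>)
  then show ?thesis
    unfolding is_tensor_over_def
    using Z pa bimodule_hom_laws[OF p] by (auto intro!: bexI[of _ p])
qed

end


section \<open>Relative tensor products over a separable Frobenius algebra\<close>

locale separable_frobenius_algebra = algebra_object K C A
  for K :: "('k, 'r) ring_scheme" and C :: "('o, 'm, 'k, 'z) ribbon_data_scheme" (structure)
    and A :: "('o, 'm) frobenius_data" +
  assumes frobenius: "is_frobenius_algebra C A"
    and separable: "mul A \<cdot> cmul A = ident C (aobj A)"
    and idem_complete: "idempotent_complete C"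
begin

text \<open>
  The separability element: in elements it is central in \<open>A \<otimes> A\<close> for the outer actions (both
  \<open>casimir_left\<close> and \<open>casimir_right\<close> compute the same arrow \<open>\<Delta>\<close>), and it multiplies to the unit.
\<close>

definition casimir :: 'm where "casimir = cmul A \<cdot> eta"

lemma cmul_arr [simp]: "cmul A \<in> Arr C" "Dom C (cmul A) = a" "Cod C (cmul A) = a \<otimes>\<^sub>o a"
  using frobenius by (simp_all add: is_frobenius_algebra_def is_coalgebra_def)

lemma casimir_arr [simp]:
  "casimir \<in> Arr C" "Dom C casimir = unit C" "Cod C casimir = a \<otimes>\<^sub>o a"
  by (simp_all add: casimir_def)

lemma mul_casimir: "mu \<cdot> casimir = eta"
  using separable by (simp add: casimir_def flip: comp_assoc_arr)

lemma casimir_left: "(mu \<otimes>\<^sub>a idn a) \<cdot> (idn a \<otimes>\<^sub>a casimir) = cmul A"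
proof -
  have "(mu \<otimes>\<^sub>a idn a) \<cdot> (idn a \<otimes>\<^sub>a casimir)
      = ((mu \<otimes>\<^sub>a idn a) \<cdot> (idn a \<otimes>\<^sub>a cmul A)) \<cdot> (idn a \<otimes>\<^sub>a eta)"
    by (simp add: casimir_def comp_assoc_arr comp_tensor)
  also have "(mu \<otimes>\<^sub>a idn a) \<cdot> (idn a \<otimes>\<^sub>a cmul A) = cmul A \<cdot> mu"
    using frobenius by (simp add: is_frobenius_algebra_def)
  finally show ?thesis by (simp add: comp_assoc_arr algebra_laws)
qed

lemma casimir_right: "(idn a \<otimes>\<^sub>a mu) \<cdot> (casimir \<otimes>\<^sub>a idn a) = cmul A"
proof -
  have "(idn a \<otimes>\<^sub>a mu) \<cdot> (casimir \<otimes>\<^sub>a idn a)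
      = ((idn a \<otimes>\<^sub>a mu) \<cdot> (cmul A \<otimes>\<^sub>a idn a)) \<cdot> (eta \<otimes>\<^sub>a idn a)"
    by (simp add: casimir_def comp_assoc_arr comp_tensor)
  also have "(idn a \<otimes>\<^sub>a mu) \<cdot> (cmul A \<otimes>\<^sub>a idn a) = cmul A \<cdot> mu"
    using frobenius by (simp add: is_frobenius_algebra_def)
  finally show ?thesis by (simp add: comp_assoc_arr algebra_laws)
qed

text \<open>
  In elements, \<open>x \<otimes> y \<mapsto> \<Sum> x c\<^sub>1 \<otimes> c\<^sub>2 y\<close>, where \<open>\<Sum> c\<^sub>1 \<otimes> c\<^sub>2\<close> is the separability element.
\<close>

definition proj :: "('o, 'm) bimodule_data \<Rightarrow> ('o, 'm) bimodule_data \<Rightarrow> 'm" where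
  "proj X Y = (ract X \<otimes>\<^sub>a lact Y) \<cdot> (idn (bobj X) \<otimes>\<^sub>a (casimir \<otimes>\<^sub>a idn (bobj Y)))"

lemma proj_arr [simp]:
  assumes "is_bimodule C A X" "is_bimodule C A Y"
  shows "proj X Y \<in> Arr C" "Dom C (proj X Y) = bobj X \<otimes>\<^sub>o bobj Y"
    "Cod C (proj X Y) = bobj X \<otimes>\<^sub>o bobj Y"
  using assms by (simp_all add: proj_def)

lemma proj_comp:
  assumes X: "is_bimodule C A X" "is_bimodule C A Y"
    and u: "u \<in> Arr C" "Cod C u = bobj X" "v \<in> Arr C" "Cod C v = bobj Y"
  shows "proj X Y \<cdot> (u \<otimes>\<^sub>a v) = (ract X \<otimes>\<^sub>a lact Y) \<cdot> (u \<otimes>\<^sub>a (casimir \<otimes>\<^sub>a v))"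
proof -
  have "(casimir \<otimes>\<^sub>a idn (bobj Y)) \<cdot> v = (casimir \<otimes>\<^sub>a idn (bobj Y)) \<cdot> (idn (unit C) \<otimes>\<^sub>a v)"
    using u by simp
  also have "\<dots> = casimir \<otimes>\<^sub>a v" using X u by (subst comp_tensor) simp_all
  finally have "(casimir \<otimes>\<^sub>a idn (bobj Y)) \<cdot> v = casimir \<otimes>\<^sub>a v" .
  then show ?thesis using X u by (simp add: proj_def comp_assoc_arr comp_tensor)
qed

text \<open>
  The idempotent is built from the two actions, with which \<open>f\<close> and \<open>g\<close> commute, and from an
  element inserted between them, which they do not touch.
\<close>

lemma proj_natural:
  assumes X: "is_bimodule C A X" "is_bimodule C A X'" "is_bimodule C A Y" "is_bimodule C A Y'"
    and f: "f \<in> bimodule_hom C A X X'" and g: "g \<in> bimodule_hom C A Y Y'"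
  shows "(f \<otimes>\<^sub>a g) \<cdot> proj X Y = proj X' Y' \<cdot> (f \<otimes>\<^sub>a g)"
proof -
  note [simp] = bimodule_hom_arr[OF f] bimodule_hom_arr[OF g] X
  have cas: "(idn (a \<otimes>\<^sub>o a) \<otimes>\<^sub>a g) \<cdot> (casimir \<otimes>\<^sub>a idn (bobj Y)) = casimir \<otimes>\<^sub>a g"
    by (simp add: comp_tensor)
  have "(f \<otimes>\<^sub>a g) \<cdot> proj X Y
      = ((f \<cdot> ract X) \<otimes>\<^sub>a (g \<cdot> lact Y)) \<cdot> (idn (bobj X) \<otimes>\<^sub>a (casimir \<otimes>\<^sub>a idn (bobj Y)))"
    by (simp add: proj_def comp_tensor flip: comp_assoc_arr)
  also have "\<dots> = (ract X' \<otimes>\<^sub>a lact Y') \<cdot> (((f \<otimes>\<^sub>a idn a) \<otimes>\<^sub>a (idn a \<otimes>\<^sub>a g))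
      \<cdot> (idn (bobj X) \<otimes>\<^sub>a (casimir \<otimes>\<^sub>a idn (bobj Y))))"
    by (simp add: bimodule_hom_laws(2)[OF f] bimodule_hom_laws(1)[OF g] comp_tensor
        flip: comp_assoc_arr)
  also have "(f \<otimes>\<^sub>a idn a) \<otimes>\<^sub>a (idn a \<otimes>\<^sub>a g) = f \<otimes>\<^sub>a (idn (a \<otimes>\<^sub>o a) \<otimes>\<^sub>a g)"
    by (simp add: tensor_arr_assoc flip: tensor_ident)
  also have "\<dots> \<cdot> (idn (bobj X) \<otimes>\<^sub>a (casimir \<otimes>\<^sub>a idn (bobj Y))) = f \<otimes>\<^sub>a (casimir \<otimes>\<^sub>a g)"
    by (simp add: comp_tensor cas)
  finally show ?thesis by (simp add: proj_comp)
qed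

text \<open>
  Moving an element of \<open>A\<close> from the right of \<open>X\<close> to the left of \<open>Y\<close> moves it across the separability
  element: both composites equal the arrow that applies \<open>\<Delta>\<close> to the middle factor of
  \<open>X \<otimes> A \<otimes> Y\<close> and then lets the two legs act.
\<close>

lemma proj_balanced:
  assumes X: "is_bimodule C A X" and Y: "is_bimodule C A Y"
  shows "balanced X Y (proj X Y)"
proof -
  let ?X = "idn (bobj X)" and ?Y = "idn (bobj Y)"
  note [simp] = X Y
  have "proj X Y \<cdot> (ract X \<otimes>\<^sub>a ?Y) = (ract X \<otimes>\<^sub>a lact Y) \<cdot> (ract X \<otimes>\<^sub>a (casimir \<otimes>\<^sub>a ?Y))"
    by (simp add: proj_comp)
  also have "ract X \<otimes>\<^sub>a (casimir \<otimes>\<^sub>a ?Y)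
      = (ract X \<otimes>\<^sub>a idn (a \<otimes>\<^sub>o (a \<otimes>\<^sub>o bobj Y))) \<cdot> (idn (bobj X \<otimes>\<^sub>o a) \<otimes>\<^sub>a (casimir \<otimes>\<^sub>a ?Y))"
    by (simp add: comp_tensor)
  also have "ract X \<otimes>\<^sub>a idn (a \<otimes>\<^sub>o (a \<otimes>\<^sub>o bobj Y)) = (ract X \<otimes>\<^sub>a idn a) \<otimes>\<^sub>a (idn a \<otimes>\<^sub>a ?Y)"
    by (simp add: tensor_arr_assoc tensor_ident)
  also have "(ract X \<otimes>\<^sub>a lact Y) \<cdot> (((ract X \<otimes>\<^sub>a idn a) \<otimes>\<^sub>a (idn a \<otimes>\<^sub>a ?Y))
        \<cdot> (idn (bobj X \<otimes>\<^sub>o a) \<otimes>\<^sub>a (casimir \<otimes>\<^sub>a ?Y)))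
      = ((ract X \<cdot> (?X \<otimes>\<^sub>a mu)) \<otimes>\<^sub>a lact Y) \<cdot> (idn (bobj X \<otimes>\<^sub>o a) \<otimes>\<^sub>a (casimir \<otimes>\<^sub>a ?Y))"
    by (simp add: bimodule_laws(3)[OF X] comp_tensor tensor_ident flip: comp_assoc_arr)
  also have "\<dots> = (ract X \<otimes>\<^sub>a lact Y)
      \<cdot> (((?X \<otimes>\<^sub>a mu) \<otimes>\<^sub>a (idn a \<otimes>\<^sub>a ?Y)) \<cdot> (idn (bobj X \<otimes>\<^sub>o a) \<otimes>\<^sub>a (casimir \<otimes>\<^sub>a ?Y)))"
    by (simp add: comp_tensor tensor_ident flip: comp_assoc_arr)
  also have "(?X \<otimes>\<^sub>a mu) \<otimes>\<^sub>a (idn a \<otimes>\<^sub>a ?Y) = ?X \<otimes>\<^sub>a ((mu \<otimes>\<^sub>a idn a) \<otimes>\<^sub>a ?Y)"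
    by (simp add: tensor_arr_assoc)
  also have "idn (bobj X \<otimes>\<^sub>o a) \<otimes>\<^sub>a (casimir \<otimes>\<^sub>a ?Y) = ?X \<otimes>\<^sub>a ((idn a \<otimes>\<^sub>a casimir) \<otimes>\<^sub>a ?Y)"
    by (simp add: tensor_arr_assoc flip: tensor_ident)
  also have "(?X \<otimes>\<^sub>a ((mu \<otimes>\<^sub>a idn a) \<otimes>\<^sub>a ?Y)) \<cdot> (?X \<otimes>\<^sub>a ((idn a \<otimes>\<^sub>a casimir) \<otimes>\<^sub>a ?Y))
      = ?X \<otimes>\<^sub>a (cmul A \<otimes>\<^sub>a ?Y)"
    by (simp add: comp_tensor casimir_left)
  \<comment> \<open>Both sides are brought to this form, with \<open>\<Delta>\<close> on the middle factor.\<close>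
  finally have left: "proj X Y \<cdot> (ract X \<otimes>\<^sub>a ?Y) = (ract X \<otimes>\<^sub>a lact Y) \<cdot> (?X \<otimes>\<^sub>a (cmul A \<otimes>\<^sub>a ?Y))" .
  have "proj X Y \<cdot> (?X \<otimes>\<^sub>a lact Y) = (ract X \<otimes>\<^sub>a lact Y) \<cdot> (?X \<otimes>\<^sub>a (casimir \<otimes>\<^sub>a lact Y))"
    by (simp add: proj_comp)
  also have "?X \<otimes>\<^sub>a (casimir \<otimes>\<^sub>a lact Y)
      = (?X \<otimes>\<^sub>a (idn (a \<otimes>\<^sub>o a) \<otimes>\<^sub>a lact Y)) \<cdot> (?X \<otimes>\<^sub>a (casimir \<otimes>\<^sub>a idn (a \<otimes>\<^sub>o bobj Y)))"
    by (simp add: comp_tensor)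
  also have "?X \<otimes>\<^sub>a (idn (a \<otimes>\<^sub>o a) \<otimes>\<^sub>a lact Y) = (?X \<otimes>\<^sub>a idn a) \<otimes>\<^sub>a (idn a \<otimes>\<^sub>a lact Y)"
    by (simp add: tensor_arr_assoc flip: tensor_ident)
  also have "(ract X \<otimes>\<^sub>a lact Y) \<cdot> (((?X \<otimes>\<^sub>a idn a) \<otimes>\<^sub>a (idn a \<otimes>\<^sub>a lact Y))
        \<cdot> (?X \<otimes>\<^sub>a (casimir \<otimes>\<^sub>a idn (a \<otimes>\<^sub>o bobj Y))))
      = (ract X \<otimes>\<^sub>a (lact Y \<cdot> (mu \<otimes>\<^sub>a ?Y))) \<cdot> (?X \<otimes>\<^sub>a (casimir \<otimes>\<^sub>a idn (a \<otimes>\<^sub>o bobj Y)))"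
    by (simp add: bimodule_laws(1)[OF Y] comp_tensor tensor_ident flip: comp_assoc_arr)
  also have "\<dots> = (ract X \<otimes>\<^sub>a lact Y)
      \<cdot> (((?X \<otimes>\<^sub>a idn a) \<otimes>\<^sub>a (mu \<otimes>\<^sub>a ?Y)) \<cdot> (?X \<otimes>\<^sub>a (casimir \<otimes>\<^sub>a idn (a \<otimes>\<^sub>o bobj Y))))"
    by (simp add: comp_tensor tensor_ident flip: comp_assoc_arr)
  also have "(?X \<otimes>\<^sub>a idn a) \<otimes>\<^sub>a (mu \<otimes>\<^sub>a ?Y) = ?X \<otimes>\<^sub>a ((idn a \<otimes>\<^sub>a mu) \<otimes>\<^sub>a ?Y)"
    by (simp add: tensor_arr_assoc)
  also have "casimir \<otimes>\<^sub>a idn (a \<otimes>\<^sub>o bobj Y) = (casimir \<otimes>\<^sub>a idn a) \<otimes>\<^sub>a ?Y"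
    by (simp add: tensor_arr_assoc tensor_ident)
  also have "(?X \<otimes>\<^sub>a ((idn a \<otimes>\<^sub>a mu) \<otimes>\<^sub>a ?Y)) \<cdot> (?X \<otimes>\<^sub>a ((casimir \<otimes>\<^sub>a idn a) \<otimes>\<^sub>a ?Y))
      = ?X \<otimes>\<^sub>a (cmul A \<otimes>\<^sub>a ?Y)"
    by (simp add: comp_tensor casimir_right)
  finally show ?thesis using left by (simp add: balanced_def)
qed

text \<open>
  A balanced arrow lets the first leg of the separability element act on \<open>Y\<close> instead of \<open>X\<close>.
  There both legs act through their product, which is the unit.
\<close>

lemma balanced_proj:
  assumes X: "is_bimodule C A X" and Y: "is_bimodule C A Y" and h: "balanced X Y h"
  shows "h \<cdot> proj X Y = h"
proof -
  let ?X = "idn (bobj X)" and ?Y = "idn (bobj Y)"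
  note [simp] = X Y
  have [simp]: "h \<in> Arr C" "Dom C h = bobj X \<otimes>\<^sub>o bobj Y"
    and bal: "h \<cdot> (ract X \<otimes>\<^sub>a ?Y) = h \<cdot> (?X \<otimes>\<^sub>a lact Y)"
    using h by (simp_all add: balanced_def)
  let ?c = "?X \<otimes>\<^sub>a (casimir \<otimes>\<^sub>a ?Y)"
  have "ract X \<otimes>\<^sub>a lact Y = (ract X \<otimes>\<^sub>a ?Y) \<cdot> ((?X \<otimes>\<^sub>a idn a) \<otimes>\<^sub>a lact Y)"
    by (simp add: comp_tensor tensor_ident)
  then have "h \<cdot> proj X Y = (h \<cdot> (ract X \<otimes>\<^sub>a ?Y)) \<cdot> (((?X \<otimes>\<^sub>a idn a) \<otimes>\<^sub>a lact Y) \<cdot> ?c)"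
    by (simp add: proj_def comp_assoc_arr)
  also have "\<dots> = h \<cdot> ((?X \<otimes>\<^sub>a lact Y) \<cdot> ((?X \<otimes>\<^sub>a (idn a \<otimes>\<^sub>a lact Y)) \<cdot> ?c))"
    by (simp add: bal comp_assoc_arr tensor_arr_assoc)
  also have "(?X \<otimes>\<^sub>a lact Y) \<cdot> ((?X \<otimes>\<^sub>a (idn a \<otimes>\<^sub>a lact Y)) \<cdot> ?c)
      = ?X \<otimes>\<^sub>a ((lact Y \<cdot> (idn a \<otimes>\<^sub>a lact Y)) \<cdot> (casimir \<otimes>\<^sub>a ?Y))"
    by (simp add: comp_tensor comp_assoc_arr)
  also have "\<dots> = ?X \<otimes>\<^sub>a (lact Y \<cdot> (eta \<otimes>\<^sub>a ?Y))"
    by (simp add: comp_tensor comp_assoc_arr mul_casimir flip: bimodule_laws(1)[OF Y])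
  finally show ?thesis by (simp add: bimodule_laws(2)[OF Y] tensor_ident)
qed

text \<open>
  The idempotent sees only the inner actions, so an outer tensor factor is carried along.
  These two identities turn naturality into linearity (\<open>proj_hom\<close>), and in
  \<open>tensor_over_assoc\<close> they identify the idempotents of the two bracketings.
\<close>

lemma proj_outer_left:
  assumes "is_bimodule C A X" "is_bimodule C A Y" "is_bimodule C A Z"
  shows "proj (X \<boxtimes> Y) Z = idn (bobj X) \<otimes>\<^sub>a proj Y Z"
proof -
  let ?X = "idn (bobj X)" and ?Y = "idn (bobj Y)" and ?Z = "idn (bobj Z)"
  have "idn (bobj X \<otimes>\<^sub>o bobj Y) \<otimes>\<^sub>a (casimir \<otimes>\<^sub>a ?Z) = ?X \<otimes>\<^sub>a (?Y \<otimes>\<^sub>a (casimir \<otimes>\<^sub>a ?Z))"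
    using assms by (simp flip: tensor_ident tensor_arr_assoc)
  then show ?thesis using assms by (simp add: proj_def tensor_arr_assoc comp_tensor)
qed

lemma proj_outer_right:
  assumes "is_bimodule C A X" "is_bimodule C A Y" "is_bimodule C A Z"
  shows "proj X (Y \<boxtimes> Z) = proj X Y \<otimes>\<^sub>a idn (bobj Z)"
proof -
  let ?X = "idn (bobj X)" and ?Y = "idn (bobj Y)" and ?Z = "idn (bobj Z)"
  have "?X \<otimes>\<^sub>a (casimir \<otimes>\<^sub>a idn (bobj Y \<otimes>\<^sub>o bobj Z)) = (?X \<otimes>\<^sub>a (casimir \<otimes>\<^sub>a ?Y)) \<otimes>\<^sub>a ?Z"
    using assms by (simp add: tensor_ident tensor_arr_assoc)
  then show ?thesis using assms by (simp add: proj_def comp_tensor flip: tensor_arr_assoc)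
qed

text \<open>
  This is naturality with respect to the actions, seen as bimodule arrows
  \<open>A \<boxtimes> X \<rightarrow> X\<close> and \<open>Y \<boxtimes> A \<rightarrow> Y\<close>.
\<close>

lemma proj_hom:
  assumes X: "is_bimodule C A X" and Y: "is_bimodule C A Y"
  shows "proj X Y \<in> bimodule_hom C A (X \<boxtimes> Y) (X \<boxtimes> Y)"
proof (rule bimodule_homI)
  note [simp] = X Y reg_bimodule outer_bimodule
  show "proj X Y \<cdot> lact (X \<boxtimes> Y) = lact (X \<boxtimes> Y) \<cdot> (idn a \<otimes>\<^sub>a proj X Y)"
    using proj_natural[OF _ _ _ _ lact_hom[OF X] bimodule_hom_ident[OF Y]]
    by (simp add: proj_outer_left)
  show "proj X Y \<cdot> ract (X \<boxtimes> Y) = ract (X \<boxtimes> Y) \<cdot> (proj X Y \<otimes>\<^sub>a idn a)"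
    using proj_natural[OF _ _ _ _ bimodule_hom_ident[OF X] ract_hom[OF Y]]
    by (simp add: proj_outer_right)
qed (use X Y in simp_all)

lemma proj_idem:
  assumes "is_bimodule C A X" "is_bimodule C A Y"
  shows "proj X Y \<cdot> proj X Y = proj X Y"
  using balanced_proj[OF assms proj_balanced[OF assms]] .

text \<open>
  Since \<open>proj X Y\<close> is balanced it factors through any coequalizer \<open>p\<close> as \<open>s \<cdot> p\<close>; as \<open>p\<close> is
  balanced too, it absorbs \<open>s \<cdot> p\<close>, which forces \<open>p \<cdot> s = id\<close>. Conversely, balanced arrows
  absorb \<open>proj X Y\<close>, so a splitting of it is a coequalizer.
\<close>

lemma tensor_over_iff_splits:
  assumes X: "is_bimodule C A X" and Y: "is_bimodule C A Y"
  shows "is_tensor_over C A X Y Z \<longleftrightarrow>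
    is_bimodule C A Z \<and> (\<exists>p s. splits (X \<boxtimes> Y) (proj X Y) Z p s)"
proof
  note XY = outer_bimodule[OF X Y]
  note [simp] = X Y
  assume T: "is_tensor_over C A X Y Z"
  then have Z [simp]: "is_bimodule C A Z" by (simp add: is_tensor_over_def)
  obtain p where p: "p \<in> Hom C (bobj X \<otimes>\<^sub>o bobj Y) (bobj Z)"
    and co: "is_coequalizer C (ract X \<otimes>\<^sub>a idn (bobj Y)) (idn (bobj X) \<otimes>\<^sub>a lact Y) p"
    and pl: "lact Z \<cdot> (idn a \<otimes>\<^sub>a p) = p \<cdot> (lact X \<otimes>\<^sub>a idn (bobj Y))"
    and pr: "ract Z \<cdot> (p \<otimes>\<^sub>a idn a) = p \<cdot> (idn (bobj X) \<otimes>\<^sub>a ract Y)"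
    using T unfolding is_tensor_over_def by blast
  have [simp]: "p \<in> Arr C" "Dom C p = bobj X \<otimes>\<^sub>o bobj Y" "Cod C p = bobj Z" using p by simp_all
  have ph: "p \<in> bimodule_hom C A (X \<boxtimes> Y) Z"
    by (rule bimodule_homI) (simp_all add: pl pr)
  have pb: "balanced X Y p" using co by (simp add: balanced_def is_coequalizer_def)
  have univ: "\<exists>!u. u \<in> Hom C (bobj Z) T \<and> u \<cdot> p = h"
    if h: "balanced X Y h" and T: "Cod C h = T" for h T
  proof -
    have h': "h \<in> Arr C" "Dom C h = bobj X \<otimes>\<^sub>o bobj Y"
      and bal: "h \<cdot> (ract X \<otimes>\<^sub>a idn (bobj Y)) = h \<cdot> (idn (bobj X) \<otimes>\<^sub>a lact Y)"
      using h unfolding balanced_def by blast+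
    have "h \<in> Hom C (Cod C (ract X \<otimes>\<^sub>a idn (bobj Y))) T" "T \<in> Obj C"
      using h' T by auto
    with bal co have "\<exists>!u. u \<in> Hom C (Cod C p) T \<and> u \<cdot> p = h"
      unfolding is_coequalizer_def by blast
    then show ?thesis by simp
  qed
  obtain s where s: "s \<in> Hom C (bobj Z) (bobj X \<otimes>\<^sub>o bobj Y)" and sp: "s \<cdot> p = proj X Y"
    using ex1_implies_ex[OF univ[OF proj_balanced[OF X Y] proj_arr(3)[OF X Y]]] by blast
  have [simp]: "s \<in> Arr C" "Dom C s = bobj Z" "Cod C s = bobj X \<otimes>\<^sub>o bobj Y" using s by simp_all
  \<comment> \<open>Both \<open>p \<cdot> s\<close> and the identity solve the factorization problem for \<open>p\<close> itself.\<close>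
  have "(p \<cdot> s) \<cdot> p = p" using balanced_proj[OF X Y pb] sp by (simp add: comp_assoc_arr)
  then have "p \<cdot> s \<in> Hom C (bobj Z) (bobj Z) \<and> p \<cdot> s \<cdot> p = p"
    "idn (bobj Z) \<in> Hom C (bobj Z) (bobj Z) \<and> idn (bobj Z) \<cdot> p = p" by simp_all
  with univ[OF pb, of "bobj Z"] \<open>Cod C p = bobj Z\<close>
  have ps: "p \<cdot> s = idn (bobj Z)" by blast
  have "s \<in> bimodule_hom C A Z (X \<boxtimes> Y)"
    by (rule section_bimodule_hom[OF XY Z ph])
      (use ps sp proj_hom[OF X Y] in simp_all)
  then show "is_bimodule C A Z \<and> (\<exists>p s. splits (X \<boxtimes> Y) (proj X Y) Z p s)"
    using ph ps sp Z by (auto simp: splits_def)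
next
  note [simp] = X Y
  assume "is_bimodule C A Z \<and> (\<exists>p s. splits (X \<boxtimes> Y) (proj X Y) Z p s)"
  then obtain p s where Z [simp]: "is_bimodule C A Z"
    and p: "p \<in> bimodule_hom C A (X \<boxtimes> Y) Z" and s: "s \<in> bimodule_hom C A Z (X \<boxtimes> Y)"
    and ps: "p \<cdot> s = idn (bobj Z)" and sp: "s \<cdot> p = proj X Y"
    by (auto simp: splits_def)
  note [simp] = bimodule_hom_arr[OF p, simplified] bimodule_hom_arr[OF s, simplified]
  have "p = (p \<cdot> s) \<cdot> p" by (simp add: ps)
  then have pP: "p = p \<cdot> proj X Y" by (simp add: sp comp_assoc_arr)
  have "balanced X Y p"
    using proj_balanced[OF X Y]
    by (subst pP) (simp add: balanced_def comp_assoc_arr)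
  then show "is_tensor_over C A X Y Z"
    using tensor_overI[OF X Y Z p _ _ ps] balanced_proj[OF X Y] by (simp add: sp)
qed


lemma tensor_over_exists:
  assumes X: "is_bimodule C A X" and Y: "is_bimodule C A Y"
  obtains Z where "is_bimodule C A Z" "is_tensor_over C A X Y Z"
proof -
  have "proj X Y \<in> Hom C (bobj X \<otimes>\<^sub>o bobj Y) (bobj X \<otimes>\<^sub>o bobj Y)" "bobj X \<otimes>\<^sub>o bobj Y \<in> Obj C"
    using X Y by simp_all
  then obtain V e r where e: "e \<in> Hom C V (bobj X \<otimes>\<^sub>o bobj Y)" and r: "r \<in> Hom C (bobj X \<otimes>\<^sub>o bobj Y) V"
    and "r \<cdot> e = idn V" "e \<cdot> r = proj X Y"
    using idem_complete proj_idem[OF X Y] unfolding idempotent_complete_def by blast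
  then obtain Z where Z: "is_bimodule C A Z" "splits (X \<boxtimes> Y) (proj X Y) Z r e"
    using idempotent_bimodule_splits[OF outer_bimodule[OF X Y] proj_hom[OF X Y], of e V r] by auto
  then have "is_tensor_over C A X Y Z" using tensor_over_iff_splits[OF X Y] by blast
  with Z(1) show thesis by (rule that)
qed

lemma tensor_over_bimodule: "is_tensor_over C A X Y Z \<Longrightarrow> is_bimodule C A Z"
  by (simp add: is_tensor_over_def)

lemma tensor_over_unique:
  assumes X: "is_bimodule C A X" and Y: "is_bimodule C A Y"
    and "is_tensor_over C A X Y Z" "is_tensor_over C A X Y Z'"
  shows "bimodule_iso C A Z Z'"
  using splits_unique[OF outer_bimodule[OF X Y]] assms
  unfolding tensor_over_iff_splits[OF X Y] by blast

lemma tensor_over_iso_args: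
  assumes X: "is_bimodule C A X" "is_bimodule C A X'" and Y: "is_bimodule C A Y" "is_bimodule C A Y'"
    and iX: "bimodule_iso C A X X'" and iY: "bimodule_iso C A Y Y'"
    and T: "is_tensor_over C A X' Y' Z"
  shows "is_tensor_over C A X Y Z"
proof -
  obtain f f' g g' where f: "f \<in> bimodule_hom C A X X'" and f': "f' \<in> bimodule_hom C A X' X"
    and g: "g \<in> bimodule_hom C A Y Y'" and g': "g' \<in> bimodule_hom C A Y' Y"
    and inv: "f' \<cdot> f = idn (bobj X)" "f \<cdot> f' = idn (bobj X')"
      "g' \<cdot> g = idn (bobj Y)" "g \<cdot> g' = idn (bobj Y')"
    using iX iY unfolding bimodule_iso_def by blast
  note [simp] = bimodule_hom_arr[OF f] bimodule_hom_arr[OF f'] bimodule_hom_arr[OF g]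
    bimodule_hom_arr[OF g'] X Y
  obtain p s where Z: "is_bimodule C A Z" and ps: "splits (X' \<boxtimes> Y') (proj X' Y') Z p s"
    using T tensor_over_iff_splits[OF X(2) Y(2)] by blast
  have "splits (X \<boxtimes> Y) (proj X Y) Z (p \<cdot> (f \<otimes>\<^sub>a g)) ((f' \<otimes>\<^sub>a g') \<cdot> s)"
    by (rule splits_transport[OF _ _ Z ps])
      (use X Y in \<open>simp_all add: outer_bimodule outer_hom f f' g g' proj_natural[OF X Y f g]
        comp_tensor inv tensor_ident\<close>)
  then show ?thesis using Z tensor_over_iff_splits[OF X(1) Y(1)] by blast
qed

lemma splits_iso_result:
  assumes M: "is_bimodule C A M" "is_bimodule C A Z" "is_bimodule C A Z'"
    and ps: "splits M P Z p s" and i: "bimodule_iso C A Z Z'"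
  shows "\<exists>p s. splits M P Z' p s"
proof -
  obtain f g where f: "f \<in> bimodule_hom C A Z Z'" and g: "g \<in> bimodule_hom C A Z' Z"
    and inv: "g \<cdot> f = idn (bobj Z)" "f \<cdot> g = idn (bobj Z')"
    using i unfolding bimodule_iso_def by blast
  have p: "p \<in> bimodule_hom C A M Z" and s: "s \<in> bimodule_hom C A Z M"
    and ps: "p \<cdot> s = idn (bobj Z)" and sp: "s \<cdot> p = P" using ps by (auto simp: splits_def)
  note [simp] = bimodule_hom_arr[OF f] bimodule_hom_arr[OF g] bimodule_hom_arr[OF p]
    bimodule_hom_arr[OF s]
  have "f \<cdot> p \<cdot> (s \<cdot> g) = f \<cdot> ((p \<cdot> s) \<cdot> g)" "s \<cdot> g \<cdot> (f \<cdot> p) = s \<cdot> ((g \<cdot> f) \<cdot> p)"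
    by (simp_all add: comp_assoc_arr)
  then have "splits M P Z' (f \<cdot> p) (s \<cdot> g)"
    unfolding splits_def
    using ps sp inv p s f g M bimodule_hom_comp by (auto simp: bimodule_hom_comp[OF M] bimodule_hom_comp[OF M(3,2,1)])
  then show ?thesis by blast
qed

lemma tensor_over_iso_result:
  assumes X: "is_bimodule C A X" and Y: "is_bimodule C A Y" and Z: "is_bimodule C A Z'"
    and "is_tensor_over C A X Y Z" "bimodule_iso C A Z Z'"
  shows "is_tensor_over C A X Y Z'"
  using assms splits_iso_result[OF outer_bimodule[OF X Y]]
  unfolding tensor_over_iff_splits[OF X Y] by blast

lemma splits_comp:
  assumes M: "is_bimodule C A M" "is_bimodule C A N" "is_bimodule C A Z"
    and "splits M P N p s" "splits N Q Z q t"
  shows "splits M (s \<cdot> (Q \<cdot> p)) Z (q \<cdot> p) (s \<cdot> t)"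
proof -
  have p: "p \<in> bimodule_hom C A M N" and s: "s \<in> bimodule_hom C A N M"
    and q: "q \<in> bimodule_hom C A N Z" and t: "t \<in> bimodule_hom C A Z N"
    and ps: "p \<cdot> s = idn (bobj N)" and qt: "q \<cdot> t = idn (bobj Z)" and tq: "t \<cdot> q = Q"
    using assms by (auto simp: splits_def)
  note [simp] = bimodule_hom_arr[OF p] bimodule_hom_arr[OF q] bimodule_hom_arr[OF s]
    bimodule_hom_arr[OF t]
  have "q \<cdot> p \<cdot> (s \<cdot> t) = q \<cdot> ((p \<cdot> s) \<cdot> t)" "s \<cdot> t \<cdot> (q \<cdot> p) = s \<cdot> ((t \<cdot> q) \<cdot> p)"
    by (simp_all add: comp_assoc_arr)
  then show ?thesis
    unfolding splits_def
    by (auto simp: ps qt tq bimodule_hom_comp[OF M p q] bimodule_hom_comp[OF M(3,2,1) t s])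
qed

lemma splits_outer:
  assumes M: "is_bimodule C A M" "is_bimodule C A N" "is_bimodule C A M'" "is_bimodule C A N'"
    and "splits M P N p s" "splits M' P' N' p' s'"
  shows "splits (M \<boxtimes> M') (P \<otimes>\<^sub>a P') (N \<boxtimes> N') (p \<otimes>\<^sub>a p') (s \<otimes>\<^sub>a s')"
proof -
  have p: "p \<in> bimodule_hom C A M N" and s: "s \<in> bimodule_hom C A N M"
    and p': "p' \<in> bimodule_hom C A M' N'" and s': "s' \<in> bimodule_hom C A N' M'"
    and ps: "p \<cdot> s = idn (bobj N)" "s \<cdot> p = P" "p' \<cdot> s' = idn (bobj N')" "s' \<cdot> p' = P'"
    using assms by (auto simp: splits_def)
  note [simp] = bimodule_hom_arr[OF p] bimodule_hom_arr[OF p'] bimodule_hom_arr[OF s]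
    bimodule_hom_arr[OF s'] M
  show ?thesis
    unfolding splits_def
    by (simp add: outer_hom p p' s s' comp_tensor ps tensor_ident)
qed

lemma splits_ident:
  "is_bimodule C A X \<Longrightarrow> splits X (idn (bobj X)) X (idn (bobj X)) (idn (bobj X))"
  by (simp add: splits_def bimodule_hom_ident)

text \<open>
  Tensoring the splitting of \<open>X \<otimes>\<^sub>A Y\<close> with \<open>Z\<close> and composing with that of \<open>(X \<otimes>\<^sub>A Y) \<otimes>\<^sub>A Z\<close>
  exhibits the latter as the image of an idempotent of \<open>X \<boxtimes> Y \<boxtimes> Z\<close>; naturality computes this
  idempotent as \<open>(proj X Y \<otimes> id) \<cdot> (id \<otimes> proj Y Z)\<close>. The other bracketing gives the same
  idempotent, and images are unique.
\<close>

lemma tensor_over_assoc: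
  assumes X: "is_bimodule C A X" and Y: "is_bimodule C A Y" and Z: "is_bimodule C A Z"
    and XY: "is_tensor_over C A X Y U" and UZ: "is_tensor_over C A U Z V"
    and YZ: "is_tensor_over C A Y Z W"
  shows "is_tensor_over C A X W V"
proof -
  have U: "is_bimodule C A U" and V: "is_bimodule C A V" and W: "is_bimodule C A W"
    using XY UZ YZ tensor_over_bimodule by blast+
  \<comment> \<open>\<open>V'\<close> is the product \<open>X \<otimes>\<^sub>A (Y \<otimes>\<^sub>A Z)\<close>, to be compared with \<open>V\<close>.\<close>
  obtain V' where V': "is_bimodule C A V'" and XW: "is_tensor_over C A X W V'"
    using tensor_over_exists[OF X W] by blast
  note [simp] = X Y Z U V W V'
  note outer = outer_bimodule[OF X Y] outer_bimodule[OF Y Z] outer_bimodule[OF U Z]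
    outer_bimodule[OF X W]
  note [simp] = outer
  let ?X = "idn (bobj X)" and ?Z = "idn (bobj Z)"
  let ?Q = "(proj X Y \<otimes>\<^sub>a ?Z) \<cdot> (?X \<otimes>\<^sub>a proj Y Z)"
  have XYZ: "is_bimodule C A (X \<boxtimes> (Y \<boxtimes> Z))" by (simp add: outer_bimodule)
  obtain p s where ps: "splits (X \<boxtimes> Y) (proj X Y) U p s"
    using XY tensor_over_iff_splits[OF X Y] by blast
  then have p: "p \<in> bimodule_hom C A (X \<boxtimes> Y) U" and s: "s \<in> bimodule_hom C A U (X \<boxtimes> Y)"
    and sp: "s \<cdot> p = proj X Y" by (auto simp: splits_def)
  obtain q t where qt: "splits (U \<boxtimes> Z) (proj U Z) V q t"
    using UZ tensor_over_iff_splits[OF U Z] by blast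
  obtain p' s' where ps': "splits (Y \<boxtimes> Z) (proj Y Z) W p' s'"
    using YZ tensor_over_iff_splits[OF Y Z] by blast
  then have p': "p' \<in> bimodule_hom C A (Y \<boxtimes> Z) W" and s': "s' \<in> bimodule_hom C A W (Y \<boxtimes> Z)"
    and sp': "s' \<cdot> p' = proj Y Z" by (auto simp: splits_def)
  obtain q' t' where qt': "splits (X \<boxtimes> W) (proj X W) V' q' t'"
    using XW tensor_over_iff_splits[OF X W] by blast
  note [simp] = bimodule_hom_arr[OF p, simplified] bimodule_hom_arr[OF s, simplified]
    bimodule_hom_arr[OF p', simplified] bimodule_hom_arr[OF s', simplified]
  have "splits ((X \<boxtimes> Y) \<boxtimes> Z) (proj X Y \<otimes>\<^sub>a ?Z) (U \<boxtimes> Z) (p \<otimes>\<^sub>a ?Z) (s \<otimes>\<^sub>a ?Z)"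
    by (rule splits_outer[OF _ _ _ _ ps splits_ident]) simp_all
  then have "splits (X \<boxtimes> (Y \<boxtimes> Z)) (proj X Y \<otimes>\<^sub>a ?Z) (U \<boxtimes> Z) (p \<otimes>\<^sub>a ?Z) (s \<otimes>\<^sub>a ?Z)"
    by (simp add: outer_assoc)
  note left = splits_comp[OF XYZ outer(3) V this qt]
  have "(s \<otimes>\<^sub>a ?Z) \<cdot> (proj U Z \<cdot> (p \<otimes>\<^sub>a ?Z)) = (s \<otimes>\<^sub>a ?Z) \<cdot> ((p \<otimes>\<^sub>a ?Z) \<cdot> proj (X \<boxtimes> Y) Z)"
    using proj_natural[OF outer(1) U Z Z p bimodule_hom_ident[OF Z]] by simp
  also have "\<dots> = ((s \<cdot> p) \<otimes>\<^sub>a ?Z) \<cdot> proj (X \<boxtimes> Y) Z"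
    by (simp add: comp_tensor flip: comp_assoc_arr)
  also have "\<dots> = ?Q"
    by (simp add: sp proj_outer_left)
  finally have l: "(s \<otimes>\<^sub>a ?Z) \<cdot> (proj U Z \<cdot> (p \<otimes>\<^sub>a ?Z)) = ?Q" .
  have "splits (X \<boxtimes> (Y \<boxtimes> Z)) (?X \<otimes>\<^sub>a proj Y Z) (X \<boxtimes> W) (?X \<otimes>\<^sub>a p') (?X \<otimes>\<^sub>a s')"
    by (rule splits_outer[OF _ _ _ _ splits_ident ps']) simp_all
  note right = splits_comp[OF XYZ outer(4) V' this qt']
  have "(?X \<otimes>\<^sub>a s') \<cdot> (proj X W \<cdot> (?X \<otimes>\<^sub>a p')) = ((?X \<otimes>\<^sub>a s') \<cdot> proj X W) \<cdot> (?X \<otimes>\<^sub>a p')"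
    by (simp add: comp_assoc_arr)
  also have "\<dots> = (proj X (Y \<boxtimes> Z) \<cdot> (?X \<otimes>\<^sub>a s')) \<cdot> (?X \<otimes>\<^sub>a p')"
    using proj_natural[OF X X W outer(2) bimodule_hom_ident[OF X] s'] by simp
  also have "\<dots> = ?Q"
    by (simp add: comp_assoc_arr comp_tensor sp' proj_outer_right)
  finally have r: "(?X \<otimes>\<^sub>a s') \<cdot> (proj X W \<cdot> (?X \<otimes>\<^sub>a p')) = ?Q" .
  have "bimodule_iso C A V' V"
    using splits_unique[OF XYZ V' V right[unfolded r] left[unfolded l]] .
  then show ?thesis using tensor_over_iso_result[OF X W V XW] by blast
qed

text \<open>
  The unit of \<open>A\<close> provides a section \<open>x \<mapsto> 1 \<otimes> x\<close> of the action; a balanced \<open>h\<close> absorbs the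
  resulting projector because \<open>h(1 \<otimes> bx) = h(b \<otimes> x)\<close>.
\<close>

lemma tensor_over_unit_left:
  assumes X: "is_bimodule C A X"
  shows "is_tensor_over C A reg X X"
proof (rule tensor_overI[OF reg_bimodule X X lact_hom[OF X]])
  let ?X = "idn (bobj X)"
  note [simp] = X
  show "balanced reg X (lact X)" by (simp add: balanced_def bimodule_laws(1)[OF X])
  show "eta \<otimes>\<^sub>a ?X \<in> Hom C (bobj X) (bobj reg \<otimes>\<^sub>o bobj X)" by simp
  show "lact X \<cdot> (eta \<otimes>\<^sub>a ?X) = ?X" by (rule bimodule_laws(2)[OF X])
  fix h assume "balanced reg X h"
  then have [simp]: "h \<in> Arr C" "Dom C h = a \<otimes>\<^sub>o bobj X"
    and bal: "h \<cdot> (mu \<otimes>\<^sub>a ?X) = h \<cdot> (idn a \<otimes>\<^sub>a lact X)" by (simp_all add: balanced_def)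
  have "(eta \<otimes>\<^sub>a ?X) \<cdot> lact X = (eta \<otimes>\<^sub>a ?X) \<cdot> (idn (unit C) \<otimes>\<^sub>a lact X)" by simp
  also have "\<dots> = eta \<otimes>\<^sub>a lact X" by (subst comp_tensor) simp_all
  also have "\<dots> = (idn a \<otimes>\<^sub>a lact X) \<cdot> (eta \<otimes>\<^sub>a idn (a \<otimes>\<^sub>o bobj X))" by (simp add: comp_tensor)
  finally have "h \<cdot> ((eta \<otimes>\<^sub>a ?X) \<cdot> lact X) = (h \<cdot> (idn a \<otimes>\<^sub>a lact X)) \<cdot> ((eta \<otimes>\<^sub>a idn a) \<otimes>\<^sub>a ?X)"
    by (simp add: comp_assoc_arr tensor_arr_assoc tensor_ident)
  also have "\<dots> = h \<cdot> ((mu \<cdot> (eta \<otimes>\<^sub>a idn a)) \<otimes>\<^sub>a ?X)"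
    by (simp add: comp_assoc_arr comp_tensor flip: bal)
  finally show "h \<cdot> ((eta \<otimes>\<^sub>a ?X) \<cdot> lact X) = h" by (simp add: algebra_laws tensor_ident)
qed

lemma tensor_over_unit_right:
  assumes X: "is_bimodule C A X"
  shows "is_tensor_over C A X reg X"
proof (rule tensor_overI[OF X reg_bimodule X ract_hom[OF X]])
  let ?X = "idn (bobj X)"
  note [simp] = X
  show "balanced X reg (ract X)" by (simp add: balanced_def bimodule_laws(3)[OF X])
  show "?X \<otimes>\<^sub>a eta \<in> Hom C (bobj X) (bobj X \<otimes>\<^sub>o bobj reg)" by simp
  show "ract X \<cdot> (?X \<otimes>\<^sub>a eta) = ?X" by (rule bimodule_laws(4)[OF X])
  fix h assume "balanced X reg h"
  then have [simp]: "h \<in> Arr C" "Dom C h = bobj X \<otimes>\<^sub>o a"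
    and bal: "h \<cdot> (ract X \<otimes>\<^sub>a idn a) = h \<cdot> (?X \<otimes>\<^sub>a mu)" by (simp_all add: balanced_def)
  have "(?X \<otimes>\<^sub>a eta) \<cdot> ract X = (?X \<otimes>\<^sub>a eta) \<cdot> (ract X \<otimes>\<^sub>a idn (unit C))" by simp
  also have "\<dots> = ract X \<otimes>\<^sub>a eta" by (subst comp_tensor) simp_all
  also have "\<dots> = (ract X \<otimes>\<^sub>a idn a) \<cdot> (idn (bobj X \<otimes>\<^sub>o a) \<otimes>\<^sub>a eta)" by (simp add: comp_tensor)
  finally have "h \<cdot> ((?X \<otimes>\<^sub>a eta) \<cdot> ract X) = (h \<cdot> (ract X \<otimes>\<^sub>a idn a)) \<cdot> (?X \<otimes>\<^sub>a (idn a \<otimes>\<^sub>a eta))"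
    by (simp add: comp_assoc_arr flip: tensor_arr_assoc tensor_ident)
  also have "\<dots> = h \<cdot> (?X \<otimes>\<^sub>a (mu \<cdot> (idn a \<otimes>\<^sub>a eta)))"
    by (simp add: comp_assoc_arr comp_tensor bal)
  finally show "h \<cdot> ((?X \<otimes>\<^sub>a eta) \<cdot> ract X) = h" by (simp add: algebra_laws tensor_ident)
qed


section \<open>The Picard group\<close>

abbreviation cls :: "('o, 'm) bimodule_data \<Rightarrow> ('o, 'm) bimodule_data set" where
  "cls \<equiv> iso_class C A"

lemma cls_eq_iff:
  assumes "is_bimodule C A X" "is_bimodule C A Y"
  shows "cls X = cls Y \<longleftrightarrow> bimodule_iso C A X Y"
proof
  assume "cls X = cls Y"
  moreover have "Y \<in> cls Y" using assms bimodule_iso_refl by (simp add: iso_class_def)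
  ultimately show "bimodule_iso C A X Y" by (auto simp: iso_class_def)
next
  assume "bimodule_iso C A X Y"
  then show "cls X = cls Y"
    using assms bimodule_iso_trans bimodule_iso_sym unfolding iso_class_def by blast
qed

text \<open>
  The product of classes in \<open>Pic\<close> is the set of all tensor products of representatives; that
  this set is a single class says that tensor products are invariant under
  isomorphism in the factors and in the result, and unique up to isomorphism.
\<close>

lemma cls_mult:
  assumes X: "is_bimodule C A X" and Y: "is_bimodule C A Y" and T: "is_tensor_over C A X Y Z"
  shows "cls X \<otimes>\<^bsub>Pic C A\<^esub> cls Y = cls Z"
proof -
  note Z = tensor_over_bimodule[OF T]
  have "cls X \<otimes>\<^bsub>Pic C A\<^esub> cls Y = {Z'. \<exists>X'\<in>cls X. \<exists>Y'\<in>cls Y. is_tensor_over C A X' Y' Z'}"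
    by (simp add: Pic_def)
  also have "\<dots> = cls Z"
  proof (intro equalityI subsetI)
    fix Z' assume "Z' \<in> {Z'. \<exists>X'\<in>cls X. \<exists>Y'\<in>cls Y. is_tensor_over C A X' Y' Z'}"
    then obtain X' Y' where "is_bimodule C A X'" "bimodule_iso C A X X'"
      "is_bimodule C A Y'" "bimodule_iso C A Y Y'" and T': "is_tensor_over C A X' Y' Z'"
      by (auto simp: iso_class_def)
    then have "is_tensor_over C A X Y Z'" using X Y tensor_over_iso_args by blast
    then have "bimodule_iso C A Z Z'" by (rule tensor_over_unique[OF X Y T])
    then show "Z' \<in> cls Z" using tensor_over_bimodule[OF T'] by (simp add: iso_class_def)
  next
    fix Z' assume "Z' \<in> cls Z"
    then have "is_tensor_over C A X Y Z'"
      using tensor_over_iso_result[OF X Y _ T] by (simp add: iso_class_def)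
    moreover have "X \<in> cls X" "Y \<in> cls Y"
      using X Y bimodule_iso_refl by (simp_all add: iso_class_def)
    ultimately show "Z' \<in> {Z'. \<exists>X'\<in>cls X. \<exists>Y'\<in>cls Y. is_tensor_over C A X' Y' Z'}" by blast
  qed
  finally show ?thesis .
qed

text \<open>
  The monoid of classes of all bimodules, with the product of \<open>Pic\<close>. The
  group \<open>Pic\<close> is obtained as its group of units, so that closure under products and inverses
  is a general fact about monoids.
\<close>

definition bimodule_classes :: "('o, 'm) bimodule_data set monoid" where
  "bimodule_classes = (Pic C A)\<lparr>carrier := {cls X | X. is_bimodule C A X}\<rparr>"

lemma bimodule_classes_sel [simp]:
  "x \<otimes>\<^bsub>bimodule_classes\<^esub> y = x \<otimes>\<^bsub>Pic C A\<^esub> y" "\<one>\<^bsub>bimodule_classes\<^esub> = cls reg"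
  "carrier bimodule_classes = {cls X | X. is_bimodule C A X}"
  by (simp_all add: bimodule_classes_def Pic_def)

lemma monoid_bimodule_classes: "monoid bimodule_classes"
proof (rule monoidI)
  show "\<one>\<^bsub>bimodule_classes\<^esub> \<in> carrier bimodule_classes" using reg_bimodule by auto
  fix x assume "x \<in> carrier bimodule_classes"
  then obtain X where x: "x = cls X" and X: "is_bimodule C A X" by auto
  show "\<one>\<^bsub>bimodule_classes\<^esub> \<otimes>\<^bsub>bimodule_classes\<^esub> x = x"
    "x \<otimes>\<^bsub>bimodule_classes\<^esub> \<one>\<^bsub>bimodule_classes\<^esub> = x"
    using cls_mult[OF reg_bimodule X tensor_over_unit_left[OF X]]
      cls_mult[OF X reg_bimodule tensor_over_unit_right[OF X]] by (simp_all add: x)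
  fix y assume "y \<in> carrier bimodule_classes"
  then obtain Y where y: "y = cls Y" and Y: "is_bimodule C A Y" by auto
  obtain U where U: "is_bimodule C A U" "is_tensor_over C A X Y U"
    using tensor_over_exists[OF X Y] .
  show "x \<otimes>\<^bsub>bimodule_classes\<^esub> y \<in> carrier bimodule_classes"
    using cls_mult[OF X Y U(2)] U(1) by (auto simp: x y)
  fix z assume "z \<in> carrier bimodule_classes"
  then obtain Z where z: "z = cls Z" and Z: "is_bimodule C A Z" by auto
  obtain V where V: "is_bimodule C A V" "is_tensor_over C A U Z V"
    using tensor_over_exists[OF U(1) Z] .
  obtain W where W: "is_bimodule C A W" "is_tensor_over C A Y Z W"
    using tensor_over_exists[OF Y Z] .
  show "x \<otimes>\<^bsub>bimodule_classes\<^esub> y \<otimes>\<^bsub>bimodule_classes\<^esub> z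
      = x \<otimes>\<^bsub>bimodule_classes\<^esub> (y \<otimes>\<^bsub>bimodule_classes\<^esub> z)"
    using tensor_over_assoc[OF X Y Z U(2) V(2) W(2)]
    by (simp add: x y z cls_mult[OF X Y U(2)] cls_mult[OF U(1) Z V(2)] cls_mult[OF Y Z W(2)]
        cls_mult[OF X W(1)])
qed

lemma Pic_eq_units: "Pic C A = units_of bimodule_classes"
proof -
  have mult_one: "cls X \<otimes>\<^bsub>Pic C A\<^esub> cls Y = cls reg \<longleftrightarrow>
      (\<exists>Z. is_tensor_over C A X Y Z \<and> bimodule_iso C A Z reg)"
    if X: "is_bimodule C A X" and Y: "is_bimodule C A Y" for X Y
  proof -
    obtain Z where Z: "is_bimodule C A Z" "is_tensor_over C A X Y Z"
      using tensor_over_exists[OF X Y] .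
    show ?thesis
      using Z cls_mult[OF X Y] cls_eq_iff[OF _ reg_bimodule] tensor_over_bimodule by metis
  qed
  have "carrier (Pic C A) = Units bimodule_classes"
  proof (intro equalityI subsetI)
    fix x assume "x \<in> carrier (Pic C A)"
    then obtain X where x: "x = cls X" and inv: "is_invertible_bimodule C A X"
      by (auto simp: Pic_def)
    from inv obtain Y where "is_bimodule C A X" "is_bimodule C A Y"
      "cls X \<otimes>\<^bsub>Pic C A\<^esub> cls Y = cls reg" "cls Y \<otimes>\<^bsub>Pic C A\<^esub> cls X = cls reg"
      unfolding is_invertible_bimodule_def using mult_one by blast
    then show "x \<in> Units bimodule_classes" unfolding Units_def by (auto simp: x)
  next
    fix x assume "x \<in> Units bimodule_classes"
    then obtain X Y where x: "x = cls X" and X: "is_bimodule C A X" and Y: "is_bimodule C A Y"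
      and inv: "cls X \<otimes>\<^bsub>Pic C A\<^esub> cls Y = cls reg" "cls Y \<otimes>\<^bsub>Pic C A\<^esub> cls X = cls reg"
      unfolding Units_def by auto
    have "is_invertible_bimodule C A X"
      unfolding is_invertible_bimodule_def
      using X Y inv(1)[unfolded mult_one[OF X Y]] inv(2)[unfolded mult_one[OF Y X]]
      by blast
    then show "x \<in> carrier (Pic C A)" by (auto simp: Pic_def x)
  qed
  then show ?thesis by (simp add: units_of_def bimodule_classes_def Pic_def)
qed

lemma group_Pic: "group (Pic C A)"
  unfolding Pic_eq_units by (rule monoid.units_group[OF monoid_bimodule_classes])


section \<open>Twisting the regular bimodule by an automorphism\<close>

definition twisted :: "'m \<Rightarrow> ('o, 'm) bimodule_data" where
  "twisted \<phi> = \<lparr>bobj = a, lact = mu, ract = idn a \<star> \<phi>\<rparr>"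

lemma twisted_sel [simp]:
  "bobj (twisted \<phi>) = a" "lact (twisted \<phi>) = mu" "ract (twisted \<phi>) = idn a \<star> \<phi>"
  by (simp_all add: twisted_def)

lemma twisted_ident: "twisted (idn a) = reg"
  by (simp add: twisted_def regular_bimodule_def mu_eq_conv[symmetric])

lemma twisted_bimodule:
  assumes \<phi>: "alg_hom \<phi>"
  shows "is_bimodule C A (twisted \<phi>)"
proof -
  have "(idn a \<star> \<phi>) \<cdot> (idn a \<otimes>\<^sub>a mu) = (idn a \<star> \<phi>) \<cdot> ((idn a \<star> \<phi>) \<otimes>\<^sub>a idn a)"
    "(idn a \<star> \<phi>) \<cdot> (idn a \<otimes>\<^sub>a eta) = idn a"
    using \<phi> by (simp_all add: conv_comp conv_assoc alg_hom_mul conv_unit_right)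
  moreover have "mu \<cdot> (idn a \<otimes>\<^sub>a (idn a \<star> \<phi>)) = (idn a \<star> \<phi>) \<cdot> (mu \<otimes>\<^sub>a idn a)"
    using \<phi> by (simp add: conv_comp conv_assoc mu_eq_conv)
  ultimately show ?thesis
    unfolding is_bimodule_def twisted_sel using \<phi> by (simp add: algebra_laws)
qed

text \<open>
  In elements, \<open>x \<otimes> y \<mapsto> x \<phi>(y)\<close>. It is balanced because \<open>\<phi>\<close> is multiplicative, and the
  right action of \<open>z\<close> is \<open>x \<phi>(y \<psi>(z)) = x \<phi>(y) \<phi>(\<psi>(z))\<close>, that of the twist by \<open>\<phi> \<cdot> \<psi>\<close>. Twisting
  the right action rather than the left one is what makes the map a homomorphism and not an
  antihomomorphism.
\<close>

lemma twisted_tensor: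
  assumes \<phi>: "alg_hom \<phi>" and \<psi>: "alg_hom \<psi>"
  shows "is_tensor_over C A (twisted \<phi>) (twisted \<psi>) (twisted (\<phi> \<cdot> \<psi>))"
proof (rule tensor_overI[where p = "idn a \<star> \<phi>" and s = "idn a \<otimes>\<^sub>a eta"])
  note [simp] = \<phi> \<psi> alg_hom_comp[OF \<phi> \<psi>]
  show "is_bimodule C A (twisted \<phi>)" "is_bimodule C A (twisted \<psi>)"
    "is_bimodule C A (twisted (\<phi> \<cdot> \<psi>))" by (simp_all add: twisted_bimodule)
  show "idn a \<star> \<phi> \<in> bimodule_hom C A (twisted \<phi> \<boxtimes> twisted \<psi>) (twisted (\<phi> \<cdot> \<psi>))"
  proof (rule bimodule_homI)
    show "(idn a \<star> \<phi>) \<cdot> lact (twisted \<phi> \<boxtimes> twisted \<psi>)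
        = lact (twisted (\<phi> \<cdot> \<psi>)) \<cdot> (idn a \<otimes>\<^sub>a (idn a \<star> \<phi>))"
      by (simp add: conv_comp conv_assoc mu_eq_conv)
    show "(idn a \<star> \<phi>) \<cdot> ract (twisted \<phi> \<boxtimes> twisted \<psi>)
        = ract (twisted (\<phi> \<cdot> \<psi>)) \<cdot> ((idn a \<star> \<phi>) \<otimes>\<^sub>a idn a)"
      by (simp add: conv_comp conv_assoc alg_hom_conv)
  qed simp_all
  show "balanced (twisted \<phi>) (twisted \<psi>) (idn a \<star> \<phi>)"
    by (simp add: balanced_def conv_comp conv_assoc alg_hom_mul)
  show "idn a \<otimes>\<^sub>a eta \<in> Hom C (bobj (twisted (\<phi> \<cdot> \<psi>))) (bobj (twisted \<phi>) \<otimes>\<^sub>o bobj (twisted \<psi>))"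
    by simp
  show "(idn a \<star> \<phi>) \<cdot> (idn a \<otimes>\<^sub>a eta) = idn (bobj (twisted (\<phi> \<cdot> \<psi>)))"
    by (simp add: conv_comp conv_unit_right)
  fix h assume "balanced (twisted \<phi>) (twisted \<psi>) h"
  then have [simp]: "h \<in> Arr C" "Dom C h = a \<otimes>\<^sub>o a"
    and bal: "h \<cdot> ((idn a \<star> \<phi>) \<otimes>\<^sub>a idn a) = h \<cdot> (idn a \<otimes>\<^sub>a mu)" by (simp_all add: balanced_def)
  have "(idn a \<otimes>\<^sub>a eta) \<cdot> (idn a \<star> \<phi>) = (idn a \<otimes>\<^sub>a eta) \<cdot> ((idn a \<star> \<phi>) \<otimes>\<^sub>a idn (unit C))" by simp
  also have "\<dots> = (idn a \<star> \<phi>) \<otimes>\<^sub>a eta" by (subst comp_tensor) simp_all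
  also have "\<dots> = ((idn a \<star> \<phi>) \<otimes>\<^sub>a idn a) \<cdot> (idn (a \<otimes>\<^sub>o a) \<otimes>\<^sub>a eta)" by (simp add: comp_tensor)
  finally have "h \<cdot> ((idn a \<otimes>\<^sub>a eta) \<cdot> (idn a \<star> \<phi>))
      = (h \<cdot> ((idn a \<star> \<phi>) \<otimes>\<^sub>a idn a)) \<cdot> (idn a \<otimes>\<^sub>a (idn a \<otimes>\<^sub>a eta))"
    by (simp add: comp_assoc_arr flip: tensor_arr_assoc tensor_ident)
  also have "\<dots> = h \<cdot> (idn a \<otimes>\<^sub>a (mu \<cdot> (idn a \<otimes>\<^sub>a eta)))"
    by (simp add: comp_assoc_arr comp_tensor bal)
  finally show "h \<cdot> ((idn a \<otimes>\<^sub>a eta) \<cdot> (idn a \<star> \<phi>)) = h" by (simp add: algebra_laws tensor_ident)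
qed

lemma twisted_mult:
  assumes "alg_hom \<phi>" "alg_hom \<psi>"
  shows "cls (twisted \<phi>) \<otimes>\<^bsub>Pic C A\<^esub> cls (twisted \<psi>) = cls (twisted (\<phi> \<cdot> \<psi>))"
  using cls_mult[OF _ _ twisted_tensor] twisted_bimodule assms by simp

lemma twisted_group_hom: "group_hom (Aut C A) (Pic C A) (\<lambda>\<phi>. cls (twisted \<phi>))"
proof -
  have "cls (twisted \<phi>) \<in> carrier (Pic C A)" if Aut: "\<phi> \<in> carrier (Aut C A)" for \<phi>
  proof -
    obtain \<psi> where h: "alg_hom \<phi>" "alg_hom \<psi>" and inv: "\<psi> \<cdot> \<phi> = idn a" "\<phi> \<cdot> \<psi> = idn a"
      using Aut by (auto simp: Aut_carrier_iff)
    then have "cls (twisted \<phi>) \<otimes>\<^bsub>Pic C A\<^esub> cls (twisted \<psi>) = cls reg"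
      "cls (twisted \<psi>) \<otimes>\<^bsub>Pic C A\<^esub> cls (twisted \<phi>) = cls reg"
      using h twisted_mult by (simp_all add: twisted_ident)
    then have "cls (twisted \<phi>) \<in> Units bimodule_classes"
      unfolding Units_def using h twisted_bimodule by (auto intro!: exI[of _ "cls (twisted \<psi>)"])
    then show ?thesis by (simp add: Pic_eq_units units_of_carrier)
  qed
  moreover have "cls (twisted (\<phi> \<otimes>\<^bsub>Aut C A\<^esub> \<psi>)) = cls (twisted \<phi>) \<otimes>\<^bsub>Pic C A\<^esub> cls (twisted \<psi>)"
    if "\<phi> \<in> carrier (Aut C A)" "\<psi> \<in> carrier (Aut C A)" for \<phi> \<psi>
    using that twisted_mult by (simp add: Aut_carrier_iff) (simp add: Aut_def)
  ultimately have "(\<lambda>\<phi>. cls (twisted \<phi>)) \<in> hom (Aut C A) (Pic C A)" by (auto simp: hom_def)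
  then show ?thesis
    using group_Aut group_Pic by (simp add: group_hom_def group_hom_axioms_def)
qed

lemma conjugation_alg_hom:
  assumes \<alpha>: "\<alpha> \<in> Hom C (unit C) a" and \<beta>: "\<beta> \<in> Hom C (unit C) a"
    and inv: "\<beta> \<star> \<alpha> = eta" "\<alpha> \<star> \<beta> = eta"
  shows "alg_hom (\<alpha> \<star> idn a \<star> \<beta>)"
proof (rule alg_homI)
  show "\<alpha> \<star> idn a \<star> \<beta> \<in> Arr C" "Dom C (\<alpha> \<star> idn a \<star> \<beta>) = a" "Cod C (\<alpha> \<star> idn a \<star> \<beta>) = a"
    using \<alpha> \<beta> by simp_all
  have "(\<alpha> \<star> idn a \<star> \<beta>) \<star> (\<alpha> \<star> idn a \<star> \<beta>) = \<alpha> \<star> (idn a \<star> ((\<beta> \<star> \<alpha>) \<star> (idn a \<star> \<beta>)))"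
    using \<alpha> \<beta> by (simp add: conv_assoc)
  also have "\<dots> = \<alpha> \<star> mu \<star> \<beta>"
    using \<alpha> \<beta> by (simp add: inv conv_unit_left mu_eq_conv conv_assoc)
  also have "\<dots> = (\<alpha> \<star> idn a \<star> \<beta>) \<cdot> mu"
    using \<alpha> \<beta> by (simp add: conv_point_left conv_point_right)
  finally show "(\<alpha> \<star> idn a \<star> \<beta>) \<star> (\<alpha> \<star> idn a \<star> \<beta>) = (\<alpha> \<star> idn a \<star> \<beta>) \<cdot> mu" .
  show "(\<alpha> \<star> idn a \<star> \<beta>) \<cdot> eta = eta"
    using \<alpha> \<beta> by (simp add: conv_point_left conv_point_right conv_unit_right inv)
qed

lemma conjugation_inverse:
  assumes \<alpha>: "\<alpha> \<in> Hom C (unit C) a" and \<beta>: "\<beta> \<in> Hom C (unit C) a"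
    and inv: "\<alpha> \<star> \<beta> = eta"
  shows "(\<alpha> \<star> idn a \<star> \<beta>) \<cdot> (\<beta> \<star> idn a \<star> \<alpha>) = idn a"
proof -
  have "(\<alpha> \<star> idn a \<star> \<beta>) \<cdot> (\<beta> \<star> idn a \<star> \<alpha>) = (\<alpha> \<star> \<beta>) \<star> (idn a \<star> (\<alpha> \<star> \<beta>))"
    using \<alpha> \<beta> by (simp add: conv_point_left conv_point_right conv_assoc)
  then show ?thesis by (simp add: inv conv_unit_left conv_unit_right)
qed

text \<open>
  Right multiplication by a point is left linear for free; the remaining condition is the
  intertwining relation \<open>\<phi>(x) \<alpha> = \<alpha> \<psi>(x)\<close>. Conversely, every bimodule arrow
  arises in this way from its value at the unit (\<open>bimodule_hom_twisted\<close>).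
\<close>

lemma right_mult_hom:
  assumes \<phi>: "alg_hom \<phi>" and \<psi>: "alg_hom \<psi>"
    and \<alpha>: "\<alpha> \<in> Hom C (unit C) a" and eq: "\<phi> \<star> \<alpha> = \<alpha> \<star> \<psi>"
  shows "idn a \<star> \<alpha> \<in> bimodule_hom C A (twisted \<phi>) (twisted \<psi>)"
proof (rule bimodule_homI)
  note [simp] = \<phi> \<psi>
  show "idn a \<star> \<alpha> \<in> Arr C" "Dom C (idn a \<star> \<alpha>) = bobj (twisted \<phi>)"
    "Cod C (idn a \<star> \<alpha>) = bobj (twisted \<psi>)" using \<alpha> by simp_all
  show "(idn a \<star> \<alpha>) \<cdot> lact (twisted \<phi>) = lact (twisted \<psi>) \<cdot> (idn a \<otimes>\<^sub>a (idn a \<star> \<alpha>))"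
    using \<alpha> by (simp add: mu_eq_conv conv_comp conv_point_right conv_assoc)
  show "(idn a \<star> \<alpha>) \<cdot> ract (twisted \<phi>) = ract (twisted \<psi>) \<cdot> ((idn a \<star> \<alpha>) \<otimes>\<^sub>a idn a)"
    using \<alpha> by (simp add: conv_comp conv_point_right conv_assoc eq)
qed

lemma bimodule_hom_twisted:
  assumes \<phi>: "alg_hom \<phi>" and f: "f \<in> bimodule_hom C A (twisted \<phi>) (twisted \<psi>)" and \<psi>: "alg_hom \<psi>"
  shows "f = idn a \<star> (f \<cdot> eta)" "\<phi> \<star> (f \<cdot> eta) = (f \<cdot> eta) \<star> \<psi>"
proof -
  note [simp] = \<phi> \<psi> bimodule_hom_arr[OF f, simplified]
  \<comment> \<open>Left linearity of \<open>f\<close>, evaluated at the unit in the right factor.\<close>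
  have "f \<cdot> (mu \<cdot> (idn a \<otimes>\<^sub>a eta)) = (mu \<cdot> (idn a \<otimes>\<^sub>a f)) \<cdot> (idn a \<otimes>\<^sub>a eta)"
    using bimodule_hom_laws(1)[OF f] by (simp flip: comp_assoc_arr)
  then show 1: "f = idn a \<star> (f \<cdot> eta)"
    by (simp add: algebra_laws comp_assoc_arr comp_tensor conv_def)
  \<comment> \<open>Right linearity of \<open>f\<close>, evaluated at the unit in the left factor.\<close>
  have "f \<cdot> ((idn a \<star> \<phi>) \<cdot> (eta \<otimes>\<^sub>a idn a)) = ((idn a \<star> \<psi>) \<cdot> (f \<otimes>\<^sub>a idn a)) \<cdot> (eta \<otimes>\<^sub>a idn a)"
    using bimodule_hom_laws(2)[OF f] by (simp flip: comp_assoc_arr)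
  then have "f \<cdot> \<phi> = (f \<cdot> eta) \<star> \<psi>"
    by (simp add: conv_comp conv_unit_left comp_assoc_arr comp_tensor)
  moreover have "f \<cdot> \<phi> = \<phi> \<star> (f \<cdot> eta)"
    by (subst 1) (simp add: conv_point_right)
  ultimately show "\<phi> \<star> (f \<cdot> eta) = (f \<cdot> eta) \<star> \<psi>" by simp
qed

text \<open>
  An isomorphism from \<open>A\<close> to the twist is right multiplication by a point \<open>\<beta>\<close> and its inverse is
  right multiplication by a point \<open>\<alpha>\<close>, so \<open>\<alpha>\<close> and \<open>\<beta>\<close> are inverse to each other. The
  relation \<open>x \<beta> = \<beta> \<phi>(x)\<close> then says \<open>\<phi>(x) = \<alpha> x \<beta>\<close>.
\<close>

lemma twisted_iso_reg_iff:
  assumes \<phi>: "alg_hom \<phi>"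
  shows "bimodule_iso C A reg (twisted \<phi>) \<longleftrightarrow>
    (\<exists>\<alpha>\<in>Hom C (unit C) a. \<exists>\<beta>\<in>Hom C (unit C) a.
       \<beta> \<star> \<alpha> = eta \<and> \<alpha> \<star> \<beta> = eta \<and> \<phi> = \<alpha> \<star> idn a \<star> \<beta>)"
proof
  note id = alg_hom_id
  note [simp] = \<phi>
  assume "bimodule_iso C A reg (twisted \<phi>)"
  then obtain f g where f: "f \<in> bimodule_hom C A (twisted (idn a)) (twisted \<phi>)"
    and g: "g \<in> bimodule_hom C A (twisted \<phi>) (twisted (idn a))"
    and gf: "g \<cdot> f = idn a" and fg: "f \<cdot> g = idn a"
    unfolding bimodule_iso_def by (auto simp: twisted_ident)
  note [simp] = bimodule_hom_arr[OF f, simplified] bimodule_hom_arr[OF g, simplified]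
  let ?\<beta> = "f \<cdot> eta" and ?\<alpha> = "g \<cdot> eta"
  have f_eq: "f = idn a \<star> ?\<beta>" and g_eq: "g = idn a \<star> ?\<alpha>" and comm: "idn a \<star> ?\<beta> = ?\<beta> \<star> \<phi>"
    using bimodule_hom_twisted[OF id f \<phi>] bimodule_hom_twisted[OF \<phi> g id] by blast+
  have "(f \<cdot> g) \<cdot> eta = f \<cdot> ?\<alpha>" "(g \<cdot> f) \<cdot> eta = g \<cdot> ?\<beta>" by (simp_all add: comp_assoc_arr)
  moreover have "f \<cdot> ?\<alpha> = ?\<alpha> \<star> ?\<beta>" by (subst f_eq) (simp add: conv_point_right)
  moreover have "g \<cdot> ?\<beta> = ?\<beta> \<star> ?\<alpha>" by (subst g_eq) (simp add: conv_point_right)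
  ultimately have inv: "?\<alpha> \<star> ?\<beta> = eta" "?\<beta> \<star> ?\<alpha> = eta" by (simp_all add: fg gf)
  have "?\<alpha> \<star> idn a \<star> ?\<beta> = ?\<alpha> \<star> (?\<beta> \<star> \<phi>)" by (simp add: conv_assoc comm)
  also have "\<dots> = (?\<alpha> \<star> ?\<beta>) \<star> \<phi>" by (simp add: conv_assoc)
  finally have "\<phi> = ?\<alpha> \<star> idn a \<star> ?\<beta>" by (simp add: inv conv_unit_left)
  moreover have "?\<alpha> \<in> Hom C (unit C) a" "?\<beta> \<in> Hom C (unit C) a" by simp_all
  ultimately show "\<exists>\<alpha>\<in>Hom C (unit C) a. \<exists>\<beta>\<in>Hom C (unit C) a.
       \<beta> \<star> \<alpha> = eta \<and> \<alpha> \<star> \<beta> = eta \<and> \<phi> = \<alpha> \<star> idn a \<star> \<beta>" using inv by blast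
next
  assume "\<exists>\<alpha>\<in>Hom C (unit C) a. \<exists>\<beta>\<in>Hom C (unit C) a.
       \<beta> \<star> \<alpha> = eta \<and> \<alpha> \<star> \<beta> = eta \<and> \<phi> = \<alpha> \<star> idn a \<star> \<beta>"
  then obtain \<alpha> \<beta> where \<alpha>: "\<alpha> \<in> Hom C (unit C) a" and \<beta>: "\<beta> \<in> Hom C (unit C) a"
    and inv: "\<beta> \<star> \<alpha> = eta" "\<alpha> \<star> \<beta> = eta" and \<phi>_eq: "\<phi> = \<alpha> \<star> idn a \<star> \<beta>" by blast
  have "\<beta> \<star> \<phi> = (\<beta> \<star> \<alpha>) \<star> (idn a \<star> \<beta>)" "\<phi> \<star> \<alpha> = \<alpha> \<star> (idn a \<star> (\<beta> \<star> \<alpha>))"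
    unfolding \<phi>_eq using \<alpha> \<beta> by (simp_all add: conv_assoc)
  then have "idn a \<star> \<beta> = \<beta> \<star> \<phi>" "\<phi> \<star> \<alpha> = \<alpha> \<star> idn a"
    using \<alpha> \<beta> by (simp_all add: inv conv_unit_left conv_unit_right)
  then have "idn a \<star> \<beta> \<in> bimodule_hom C A reg (twisted \<phi>)"
    "idn a \<star> \<alpha> \<in> bimodule_hom C A (twisted \<phi>) reg"
    using right_mult_hom[OF alg_hom_id \<phi> \<beta>] right_mult_hom[OF \<phi> alg_hom_id \<alpha>]
    by (simp_all add: twisted_ident)
  moreover have "(idn a \<star> \<alpha>) \<cdot> (idn a \<star> \<beta>) = idn a" "(idn a \<star> \<beta>) \<cdot> (idn a \<star> \<alpha>) = idn a"
    using \<alpha> \<beta> by (simp_all add: conv_point_right conv_assoc inv conv_unit_right)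
  ultimately show "bimodule_iso C A reg (twisted \<phi>)"
    unfolding bimodule_iso_def by (auto intro!: bexI)
qed

lemma Inn_carrier_eq:
  "carrier (Inn C A) = {\<phi>. \<exists>\<alpha>\<in>Hom C (unit C) a. \<exists>\<beta>\<in>Hom C (unit C) a.
       \<beta> \<star> \<alpha> = eta \<and> \<alpha> \<star> \<beta> = eta \<and> \<phi> = \<alpha> \<star> idn a \<star> \<beta>}"
proof -
  have "carrier (Inn C A) = {inner_aut C A \<alpha> | \<alpha>. \<alpha> \<in> Units (points C A)}"
    by (simp add: Inn_def)
  also have "\<dots> = {\<phi>. \<exists>\<alpha>\<in>Hom C (unit C) a. \<exists>\<beta>\<in>Hom C (unit C) a.
       \<beta> \<star> \<alpha> = eta \<and> \<alpha> \<star> \<beta> = eta \<and> \<phi> = \<alpha> \<star> idn a \<star> \<beta>}" (is "?I = ?J")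
  proof (intro equalityI subsetI)
    fix \<phi> assume "\<phi> \<in> ?I"
    then obtain \<alpha> \<beta> where \<phi>: "\<phi> = inner_aut C A \<alpha>"
      and \<alpha>\<beta>: "\<alpha> \<in> Hom C (unit C) a" "\<beta> \<in> Hom C (unit C) a" "\<beta> \<star> \<alpha> = eta" "\<alpha> \<star> \<beta> = eta"
      unfolding Units_points_iff by blast
    then show "\<phi> \<in> ?J" unfolding \<phi> inner_aut_eq[OF \<alpha>\<beta>] by blast
  next
    fix \<phi> assume "\<phi> \<in> ?J"
    then obtain \<alpha> \<beta> where \<phi>: "\<phi> = \<alpha> \<star> idn a \<star> \<beta>"
      and \<alpha>\<beta>: "\<alpha> \<in> Hom C (unit C) a" "\<beta> \<in> Hom C (unit C) a" "\<beta> \<star> \<alpha> = eta" "\<alpha> \<star> \<beta> = eta"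
      by blast
    then show "\<phi> \<in> ?I" unfolding \<phi> inner_aut_eq[OF \<alpha>\<beta>, symmetric] Units_points_iff by blast
  qed
  finally show ?thesis .
qed

lemma Inn_eq_kernel:
  "carrier (Inn C A) = kernel (Aut C A) (Pic C A) (\<lambda>\<phi>. cls (twisted \<phi>))"
proof -
  have ker: "cls (twisted \<phi>) = \<one>\<^bsub>Pic C A\<^esub> \<longleftrightarrow> \<phi> \<in> carrier (Inn C A)" if "alg_hom \<phi>" for \<phi>
    using twisted_iso_reg_iff[OF that] cls_eq_iff[OF reg_bimodule twisted_bimodule[OF that]]
    by (auto simp: Inn_carrier_eq Pic_def)
  have "\<phi> \<in> carrier (Aut C A)" if Inn: "\<phi> \<in> carrier (Inn C A)" for \<phi>
  proof -
    obtain \<alpha> \<beta> where \<alpha>: "\<alpha> \<in> Hom C (unit C) a" and \<beta>: "\<beta> \<in> Hom C (unit C) a"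
      and inv: "\<beta> \<star> \<alpha> = eta" "\<alpha> \<star> \<beta> = eta" and \<phi>: "\<phi> = \<alpha> \<star> idn a \<star> \<beta>"
      using Inn unfolding Inn_carrier_eq by blast
    show ?thesis
      unfolding Aut_carrier_iff \<phi>
      using conjugation_alg_hom[OF \<alpha> \<beta> inv] conjugation_alg_hom[OF \<beta> \<alpha> inv(2,1)]
        conjugation_inverse[OF \<alpha> \<beta> inv(2)] conjugation_inverse[OF \<beta> \<alpha> inv(1)] by blast
  qed
  then show ?thesis using ker unfolding kernel_def by (auto simp: Aut_carrier_iff)
qed

end


section \<open>The exact sequence\<close>

theorem proposition7:
  fixes K :: "'k ring"
    and C :: "('o, 'm, 'k) ribbon_data"
    and A :: "('o, 'm) frobenius_data"
  assumes "field K"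
    and "strict_ribbon_category K C"
    and "additive C"
    and "idempotent_complete C"
    and "simple_object C (unit C)"
    and "absolutely_simple K C (unit C)"
    and "is_frobenius_algebra C A"
    and "is_symmetric C A"
    and "is_special K C A"
  shows "\<exists>\<Psi> :: 'm \<Rightarrow> ('o, 'm) bimodule_data set.
           group_hom (Inn C A) (Aut C A) (\<lambda>\<phi>. \<phi>) \<and>
           group_hom (Aut C A) (Pic C A) \<Psi> \<and>
           inj_on (\<lambda>\<phi>. \<phi>) (carrier (Inn C A)) \<and>
           (\<lambda>\<phi>. \<phi>) ` carrier (Inn C A) = kernel (Aut C A) (Pic C A) \<Psi>"
proof -
  interpret strict_ribbon_category K C by fact
  interpret separable_frobenius_algebra K C A
    by unfold_locales
      (use assms in \<open>auto simp: is_frobenius_algebra_def is_special_def\<close>)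
  let ?\<Psi> = "\<lambda>\<phi>. iso_class C A (twisted \<phi>)"
  have "subgroup (carrier (Inn C A)) (Aut C A)"
    unfolding Inn_eq_kernel by (rule group_hom.subgroup_kernel[OF twisted_group_hom])
  then have "group_hom ((Aut C A)\<lparr>carrier := carrier (Inn C A)\<rparr>) (Aut C A) (\<lambda>\<phi>. \<phi>)"
    unfolding id_def[symmetric] by (rule group.canonical_inj_is_hom[OF group_Aut])
  moreover have "(Aut C A)\<lparr>carrier := carrier (Inn C A)\<rparr> = Inn C A"
    by (simp add: Inn_def)
  ultimately have "group_hom (Inn C A) (Aut C A) (\<lambda>\<phi>. \<phi>)" by simp
  then show ?thesis
    using twisted_group_hom Inn_eq_kernel by (intro exI[of _ ?\<Psi>]) simp
qed

end
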